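(* Let $\lambda=(\lambda_0,\lambda_1,\lambda_2,\lambda_3)\in\mathbb{R}^4$ with $\lambda_0>0$, $\lambda_1\in\mathbb{R}$, $\lambda_2>0$, $\lambda_3\ge0$, and let $G:\mathbb{R}^d\times\mathscr{P}_2(\mathbb{R}^d)\to\mathbb{R}$ be fully $C^2$ and $\lambda$-anti-monotone. Then for all $\mu\in\mathscr{P}_2(\mathbb{R}^d)$ and all $\xi\in L^2_\mu(\mathbb{R}^d;\mathbb{R}^d)$, $$\left|\int_{\mathbb{R}^d\times\mathbb{R}^d}\langle\partial_{x\mu}G(x,\mu,\tilde x)\xi(x),\xi(\tilde x)\rangle\,d\mu(x)\,d\mu(\tilde x)\right|\le\left(\frac{|\lambda_1|}{2\lambda_2}+\sqrt{\frac{\lambda_3}{\lambda_2}+\frac{\lambda_0^2}{4\lambda_2}+\left(\frac{\lambda_1}{2\lambda_2}\right)^2}\right)\int_{\mathbb{R}^d}|\xi(x)|^2\,d\mu(x)$$ and $$\left|\int_{\mathbb{R}^d}\langle\partial_{xx}G(x,\mu)\xi(x),\xi(x)\rangle\,d\mu(x)\right|\le\left(\frac{|\lambda_0|}{2}+\sqrt{\lambda_3+\left(\frac{\lambda_0}{2}\right)^2+\lambda_2\left(\frac{\lambda_1}{2\lambda_2}\right)^2}\right)\int_{\mathbb{R}^d}|\xi(x)|^2\,d\mu(x).$$ In particular, $G$ is displacement $\alpha_\lambda$-monotone, with $$\alpha_\lambda\ge\max\left\{\frac{|\lambda_1|}{2\lambda_2}+\sqrt{\frac{\lambda_3}{\lambda_2}+\frac{\lambda_0^2}{4\lambda_2}+\left(\frac{\lambda_1}{2\lambda_2}\right)^2}\,;\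 \frac{|\lambda_0|}{2}+\sqrt{\lambda_3+\left(\frac{\lambda_0}{2}\right)^2+\lambda_2\left(\frac{\lambda_1}{2\lambda_2}\right)^2}\right\}.$$
   Context: $\mathscr{P}_2(\mathbb{R}^d)$ is the set of Borel probability measures on $\mathbb{R}^d$ with finite second moment, with the 2-Wasserstein metric $W_2$. Derivatives in the measure: for $U:\mathscr{P}_2(\mathbb{R}^d)\to\mathbb{R}$, $\partial_\mu U(\mu,\tilde x)\in\mathbb{R}^d$ denotes the Wasserstein gradient (Lions derivative), i.e. the lift $\xi\mapsto U(\mathrm{Law}(\xi))$ on $L^2(\Omega;\mathbb{R}^d)$ is Fréchet differentiable with gradient $\partial_\mu U(\mathrm{Law}(\xi),\xi)$; $\partial_{x\mu}G(x,\mu,\tilde x)$ is the $d\times d$ matrix of mixed derivatives. A function is fully $C^k$ if all its derivatives up to order $k$ in the Euclidean variables, in the measure and in the extra variables exist and have jointly continuous versions. $\lambda$-anti-monotonicity: with $\lambda_0>0$, $\lambda_1\in\mathbb{R}$, $\lambda_2>0$, $\lambda_3\ge0$, a fully $C^2$ function $G:\mathbb{R}^d\times\mathscr{P}_2(\mathbb{R}^d)\to\mathbb{R}$ is $\lambda$-anti-monotone if $$\lambda_0\int\langle\partial_{xx}G(x,\mu)\xi(x),\xi(x)\rangle d\mu(x)+\lambda_1\iint\langle\partial_{x\mu}G(x,\mu,\tilde x)\xi(x),\xi(\tilde x)\rangle d\mu(x)d\mu(\tilde x)+\int|\partial_{xx}G(x,\mu)\xi(x)|^2d\mu(x)+\lambda_2\int\Big|\int\partial_{x\mu}G(x,\mu,\tilde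 x)\xi(\tilde x)d\mu(\tilde x)\Big|^2d\mu(x)\le\lambda_3\int|\xi(x)|^2d\mu(x)$$ for all $\mu\in\mathscr{P}_2(\mathbb{R}^d)$ and all $\xi\in L^2_\mu(\mathbb{R}^d;\mathbb{R}^d)$. Displacement monotonicity: a fully $C^1$ function $F:\mathbb{R}^d\times\mathscr{P}_2(\mathbb{R}^d)\to\mathbb{R}$ is displacement monotone if $\int_{\mathbb{R}^d\times\mathbb{R}^d}[\partial_xF(x,\mu)-\partial_xF(y,\nu)]\cdot(x-y)\,d\gamma(x,y)\ge0$ for all $\mu,\nu\in\mathscr{P}_2(\mathbb{R}^d)$ and all couplings $\gamma$ of $\mu$ and $\nu$; for fully $C^2$ functions this is equivalent to $\int\langle\partial_{xx}F(x,\mu)\xi(x),\xi(x)\rangle d\mu(x)+\iint\langle\partial_{x\mu}F(x,\mu,\tilde x)\xi(x),\xi(\tilde x)\rangle d\mu(x)d\mu(\tilde x)\ge0$ for all $\mu\in\mathscr{P}_2(\mathbb{R}^d)$ and $\xi\in C_c(\mathbb{R}^d;\mathbb{R}^d)$. $G$ is displacement $\alpha$-monotone ($\alpha\in\mathbb{R}$) if $(x,\mu)\mapsto G(x,\mu)+\frac{\alpha}{2}|x|^2$ is displacement monotone. *)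

theory Defs
  imports "HOL-Probability.Probability"
begin

section \<open>Square-integrable maps and the Wasserstein space\<close>

definition L2 :: "'w measure \<Rightarrow> ('w \<Rightarrow> 'b::euclidean_space) set" where
  "L2 M = {\<xi> \<in> borel_measurable M. integrable M (\<lambda>w. (norm (\<xi> w))\<^sup>2)}"

definition P2 :: "(real^'n) measure set" where
  "P2 = {\<mu>. sets \<mu> = sets borel \<and> prob_space \<mu> \<and> integrable \<mu> (\<lambda>x. (norm x)\<^sup>2)}"

definition couplings ::
    "(real^'n) measure \<Rightarrow> (real^'n) measure \<Rightarrow> ((real^'n) \<times> (real^'n)) measure set" where
  "couplings \<mu> \<nu> =
     {\<gamma>. sets \<gamma> = sets borel \<and> distr \<gamma> borel fst = \<mu> \<and> distr \<gamma> borel snd = \<nu>}"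

definition W2 :: "(real^'n) measure \<Rightarrow> (real^'n) measure \<Rightarrow> real" where
  "W2 \<mu> \<nu> = sqrt (INF \<gamma>\<in>couplings \<mu> \<nu>. (\<integral>z. (norm (fst z - snd z))\<^sup>2 \<partial>\<gamma>))"

text \<open>Joint continuity on \<open>'e \<times> P2\<close>, where \<open>P2\<close> carries the metric \<open>W2\<close>.  Several
  Euclidean variables are grouped into one variable of product type.\<close>

definition jointly_continuous ::
    "('e::metric_space \<Rightarrow> (real^'n) measure \<Rightarrow> 'b::metric_space) \<Rightarrow> bool" where
  "jointly_continuous F \<longleftrightarrow>
     (\<forall>x. \<forall>\<mu>\<in>P2. \<forall>e>0. \<exists>d>0. \<forall>x'. \<forall>\<mu>'\<in>P2.
        dist x' x < d \<and> W2 \<mu>' \<mu> < d \<longrightarrow> dist (F x' \<mu>') (F x \<mu>) < e)"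

section \<open>Derivatives\<close>

text \<open>The atomless probability space carrying the lifts is the unit interval with Lebesgue measure;
  every element of \<open>P2\<close> is the law of some element of \<open>L2 Omega\<close>.\<close>

definition Omega :: "real measure" where
  "Omega = uniform_measure lborel {0..1}"

text \<open>\<open>V \<mu> y\<close> is a version of the Wasserstein gradient of \<open>U\<close>: the lift
  \<open>\<xi> \<mapsto> U (Law \<xi>)\<close> is Frechet differentiable at each \<open>\<xi> \<in> L2 Omega\<close>, its gradient being the
  element \<open>V (Law \<xi>) \<circ> \<xi>\<close> of \<open>L2 Omega\<close>.\<close>

definition has_wasserstein_gradient ::
    "((real^'n) measure \<Rightarrow> real) \<Rightarrow> ((real^'n) measure \<Rightarrow> real^'n \<Rightarrow> real^'n) \<Rightarrow> bool" where
  "has_wasserstein_gradient U V \<longleftrightarrow>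
     (\<forall>\<xi>\<in>L2 Omega.
        (\<lambda>w. V (distr Omega borel \<xi>) (\<xi> w)) \<in> L2 Omega \<and>
        (\<forall>e>0. \<exists>d>0. \<forall>h\<in>L2 Omega. sqrt (\<integral>w. (norm (h w))\<^sup>2 \<partial>Omega) < d \<longrightarrow>
           \<bar>U (distr Omega borel (\<lambda>w. \<xi> w + h w)) - U (distr Omega borel \<xi>)
              - (\<integral>w. V (distr Omega borel \<xi>) (\<xi> w) \<bullet> h w \<partial>Omega)\<bar>
           \<le> e * sqrt (\<integral>w. (norm (h w))\<^sup>2 \<partial>Omega)))"

definition is_dmu ::
    "('e::euclidean_space \<Rightarrow> (real^'n) measure \<Rightarrow> real)
       \<Rightarrow> ('e \<Rightarrow> (real^'n) measure \<Rightarrow> real^'n \<Rightarrow> real^'n) \<Rightarrow> bool" where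
  "is_dmu F V \<longleftrightarrow>
     (\<forall>x. has_wasserstein_gradient (F x) (V x)) \<and>
     jointly_continuous (\<lambda>(x, y) \<mu>. V x \<mu> y)"

text \<open>The jointly continuous version of the Wasserstein gradient, as a function of \<open>x\<close>, \<open>\<mu>\<close> and
  the extra variable.  It is unique on \<open>P2\<close>: the values of \<open>V x \<mu>\<close> on the support of \<open>\<mu>\<close> are
  determined by continuity, the others by approximating \<open>\<mu>\<close> by measures with full support.\<close>

definition dmu ::
    "('e::euclidean_space \<Rightarrow> (real^'n) measure \<Rightarrow> real)
       \<Rightarrow> 'e \<Rightarrow> (real^'n) measure \<Rightarrow> real^'n \<Rightarrow> real^'n" where
  "dmu F = (SOME V. is_dmu F V)"

definition dx ::
    "('e::euclidean_space \<Rightarrow> (real^'n) measure \<Rightarrow> real) \<Rightarrow> 'e \<Rightarrow> (real^'n) measure \<Rightarrow> 'e" where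
  "dx F x \<mu> = (THE D. GDERIV (\<lambda>y. F y \<mu>) x :> D)"

definition fully_C1 ::
    "('e::euclidean_space \<Rightarrow> (real^'n) measure \<Rightarrow> real) \<Rightarrow> bool" where
  "fully_C1 F \<longleftrightarrow>
     jointly_continuous F \<and>
     (\<forall>x. \<forall>\<mu>\<in>P2. (\<lambda>y. F y \<mu>) differentiable (at x)) \<and>
     jointly_continuous (dx F) \<and>
     (\<exists>V. is_dmu F V)"

text \<open>The last conjunct makes every component of \<open>dmu G\<close> fully \<open>C1\<close> as a function of the measure and
  of both Euclidean variables, so that all second derivatives (in either order, in the extra
  variable, and twice in the measure) exist and are jointly continuous.\<close>

definition fully_C2 :: "(real^'n \<Rightarrow> (real^'n) measure \<Rightarrow> real) \<Rightarrow> bool" where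
  "fully_C2 G \<longleftrightarrow>
     fully_C1 G \<and>
     (\<forall>i. fully_C1 (\<lambda>x \<mu>. dx G x \<mu> $ i)) \<and>
     (\<forall>i. fully_C1 (\<lambda>(x, y) \<mu>. dmu G x \<mu> y $ i))"

definition dxx :: "(real^'n \<Rightarrow> (real^'n) measure \<Rightarrow> real) \<Rightarrow>
    real^'n \<Rightarrow> (real^'n) measure \<Rightarrow> real^'n^'n" where
  "dxx G x \<mu> = (\<chi> i. dx (\<lambda>x \<mu>. dx G x \<mu> $ i) x \<mu>)"

text \<open>Rows of \<open>dxmu G x \<mu> y\<close> are indexed by the \<open>x\<close>-derivative, columns by the components of the
  Wasserstein gradient.  A tangent vector \<open>v\<close> at \<open>x\<close> is therefore applied from the left,
  \<open>v v* dxmu G x \<mu> y\<close>, and a tangent vector \<open>w\<close> at \<open>y\<close> from the right, \<open>dxmu G x \<mu> y *v w\<close>;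
  the bilinear form is \<open>(v v* dxmu G x \<mu> y) \<bullet> w = v \<bullet> (dxmu G x \<mu> y *v w)\<close>.\<close>

definition dxmu :: "(real^'n \<Rightarrow> (real^'n) measure \<Rightarrow> real) \<Rightarrow>
    real^'n \<Rightarrow> (real^'n) measure \<Rightarrow> real^'n \<Rightarrow> real^'n^'n" where
  "dxmu G x \<mu> y = (\<chi> i. dmu (\<lambda>x \<mu>. dx G x \<mu> $ i) x \<mu> y)"

section \<open>Monotonicity\<close>

text \<open>The first four conjuncts say that the integrals in the inequality exist as finite numbers
  (integrability of the \<open>dxx\<close> quadratic form follows from the first by Cauchy-Schwarz); they are
  needed because a Bochner integral that does not exist is \<open>0\<close> in HOL.\<close>

definition anti_monotone ::
    "real \<Rightarrow> real \<Rightarrow> real \<Rightarrow> real \<Rightarrow> (real^'n \<Rightarrow> (real^'n) measure \<Rightarrow> real) \<Rightarrow> bool" where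
  "anti_monotone lam0 lam1 lam2 lam3 G \<longleftrightarrow>
     (\<forall>\<mu>\<in>P2. \<forall>\<xi>\<in>L2 \<mu>.
        (\<lambda>x. dxx G x \<mu> *v \<xi> x) \<in> L2 \<mu> \<and>
        (AE x in \<mu>. integrable \<mu> (\<lambda>y. dxmu G x \<mu> y *v \<xi> y)) \<and>
        (\<lambda>x. \<integral>y. dxmu G x \<mu> y *v \<xi> y \<partial>\<mu>) \<in> L2 \<mu> \<and>
        integrable (\<mu> \<Otimes>\<^sub>M \<mu>) (\<lambda>(x, y). (\<xi> x v* dxmu G x \<mu> y) \<bullet> \<xi> y) \<and>
        lam0 * (\<integral>x. (dxx G x \<mu> *v \<xi> x) \<bullet> \<xi> x \<partial>\<mu>)
          + lam1 * (\<integral>(x, y). (\<xi> x v* dxmu G x \<mu> y) \<bullet> \<xi> y \<partial>(\<mu> \<Otimes>\<^sub>M \<mu>))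
          + (\<integral>x. (norm (dxx G x \<mu> *v \<xi> x))\<^sup>2 \<partial>\<mu>)
          + lam2 * (\<integral>x. (norm (\<integral>y. dxmu G x \<mu> y *v \<xi> y \<partial>\<mu>))\<^sup>2 \<partial>\<mu>)
        \<le> lam3 * (\<integral>x. (norm (\<xi> x))\<^sup>2 \<partial>\<mu>))"

definition displacement_monotone :: "(real^'n \<Rightarrow> (real^'n) measure \<Rightarrow> real) \<Rightarrow> bool" where
  "displacement_monotone F \<longleftrightarrow>
     fully_C1 F \<and>
     (\<forall>\<mu>\<in>P2. \<forall>\<nu>\<in>P2. \<forall>\<gamma>\<in>couplings \<mu> \<nu>.
        integrable \<gamma> (\<lambda>(x, y). (dx F x \<mu> - dx F y \<nu>) \<bullet> (x - y)) \<and>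
        0 \<le> (\<integral>(x, y). (dx F x \<mu> - dx F y \<nu>) \<bullet> (x - y) \<partial>\<gamma>))"

definition displacement_alpha_monotone ::
    "real \<Rightarrow> (real^'n \<Rightarrow> (real^'n) measure \<Rightarrow> real) \<Rightarrow> bool" where
  "displacement_alpha_monotone \<alpha> G \<longleftrightarrow>
     displacement_monotone (\<lambda>x \<mu>. G x \<mu> + \<alpha> / 2 * (norm x)\<^sup>2)"

end

theory Submission
  imports Defs
begin

text \<open>By Cauchy--Schwarz the squares of the two quadratic forms are at most the two square terms of
  the anti-monotonicity inequality times \<open>\<integral>|\<xi>|\<^sup>2 d\<mu>\<close>; completing squares gives the two bounds.

  Displacement monotonicity holds with \<open>\<alpha>\<close> the sum of the two constants.  For a finitely supported
  coupling one differentiates \<open>\<integral>\<partial>\<^sub>xG(x\<^sub>t, \<mu>\<^sub>t) \<bullet> (x - y) d\<gamma>\<close> along \<open>x\<^sub>t = y + t (x - y)\<close>: except for finitely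
  many \<open>t\<close> the atoms do not collide, \<open>x - y\<close> is a function of \<open>x\<^sub>t\<close>, and the derivative is the sum of
  the two quadratic forms at \<open>\<mu>\<^sub>t\<close>.  A general coupling is a limit of finitely supported ones; the limit
  is dominated because anti-monotonicity also bounds \<open>\<partial>\<^sub>x\<^sub>xG\<close> uniformly, so that \<open>\<partial>\<^sub>xG\<close> is Lipschitz
  in \<open>x\<close>.\<close>

section \<open>Bounds for the quadratic forms\<close>

text \<open>The hypothesis bounds the two quadratic forms separately, while displacement
  monotonicity concerns their sum. Adding the two lower bounds produces the sum of the constants,
  which dominates their maximum because both are nonnegative.

  Anti-monotonicity speaks of vector fields over a single measure, displacement monotonicity of
  couplings. Along a general coupling the velocity \<open>x - y\<close> need not be a function of
  the interpolated point, so the inequality has no field to be tested with; this is why atoms come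
  in. Since the derivative in the measure is defined through lifts to \<open>Omega\<close>, each
  finitely supported coupling is realized there as the law of a random variable of finite range.

  The passage to the limit needs bounds on \<open>dx G\<close> at every point and uniform in the
  measure, whereas anti-monotonicity gives integrated information only. A field concentrated in one
  atom localizes it: the mass of the atom cancels from both sides.\<close>

lemma L2_D:
  assumes "f \<in> L2 M"
  shows "f \<in> borel_measurable M" "integrable M (\<lambda>w. (norm (f w))\<^sup>2)"
  using assms by (auto simp: L2_def)

lemma integrable_inner_L2:
  fixes f g :: "'w \<Rightarrow> 'b::euclidean_space"
  assumes "f \<in> L2 M" "g \<in> L2 M"
  shows "integrable M (\<lambda>w. f w \<bullet> g w)"
proof (rule Bochner_Integration.integrable_bound)
  show "integrable M (\<lambda>w. (norm (f w))\<^sup>2 + (norm (g w))\<^sup>2)"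
    using assms by (auto dest: L2_D)
  show "(\<lambda>w. f w \<bullet> g w) \<in> borel_measurable M"
    using L2_D(1)[OF assms(1)] L2_D(1)[OF assms(2)] by measurable
  have "\<bar>f w \<bullet> g w\<bar> \<le> (norm (f w))\<^sup>2 + (norm (g w))\<^sup>2" for w
  proof -
    have "\<bar>f w \<bullet> g w\<bar> \<le> norm (f w) * norm (g w)"
      by (rule Cauchy_Schwarz_ineq2)
    also have "\<dots> \<le> 2 * norm (f w) * norm (g w)" by simp
    also have "\<dots> \<le> (norm (f w))\<^sup>2 + (norm (g w))\<^sup>2"
      by (rule sum_squares_bound)
    finally show ?thesis .
  qed
  then show "AE w in M. norm (f w \<bullet> g w) \<le> norm ((norm (f w))\<^sup>2 + (norm (g w))\<^sup>2)"
    by auto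
qed

text \<open>Discriminant argument: the integral of \<open>|s f + t g|^2\<close> is a nonnegative
  quadratic form in \<open>s\<close> and \<open>t\<close>.\<close>

lemma Cauchy_Schwarz_L2:
  fixes f g :: "'w \<Rightarrow> 'b::euclidean_space"
  assumes f: "f \<in> L2 M" and g: "g \<in> L2 M"
  shows "(\<integral>w. f w \<bullet> g w \<partial>M)\<^sup>2 \<le> (\<integral>w. (norm (f w))\<^sup>2 \<partial>M) * (\<integral>w. (norm (g w))\<^sup>2 \<partial>M)"
proof -
  let ?a = "\<integral>w. (norm (f w))\<^sup>2 \<partial>M" and ?b = "\<integral>w. f w \<bullet> g w \<partial>M" and ?c = "\<integral>w. (norm (g w))\<^sup>2 \<partial>M"
  note [simp] = L2_D(2)[OF f] L2_D(2)[OF g] integrable_inner_L2[OF f g]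
  have quad: "0 \<le> s\<^sup>2 * ?a + 2 * (s * t) * ?b + t\<^sup>2 * ?c" for s t
  proof -
    have "0 \<le> (\<integral>w. (norm (s *\<^sub>R f w + t *\<^sub>R g w))\<^sup>2 \<partial>M)" by simp
    also have "\<dots> = (\<integral>w. s\<^sup>2 * (norm (f w))\<^sup>2 + (2 * (s * t)) * (f w \<bullet> g w) + t\<^sup>2 * (norm (g w))\<^sup>2 \<partial>M)"
      by (intro Bochner_Integration.integral_cong refl)
         (simp only: power2_norm_eq_inner inner_add_left inner_add_right inner_scaleR_left
            inner_scaleR_right inner_commute[of "g _" "f _"], simp add: algebra_simps power2_eq_square)
    also have "\<dots> = s\<^sup>2 * ?a + 2 * (s * t) * ?b + t\<^sup>2 * ?c" by simp
    finally show ?thesis .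
  qed
  have a: "0 \<le> ?a" and c: "0 \<le> ?c" by simp_all
  show ?thesis
  proof (cases "?c = 0")
    case True
    have "?b = 0"
    proof (rule ccontr)
      assume "?b \<noteq> 0"
      \<comment> \<open>With \<open>?c = 0\<close> the form is affine in \<open>t\<close>; this
        \<open>t\<close> gives it the value \<open>-1\<close>.\<close>
      then show False
        using quad[of 1 "- (?a + 1) / (2 * ?b)"] True by (simp add: field_simps)
    qed
    with True show ?thesis by simp
  next
    case False
    with c have "0 < ?c" by linarith
    \<comment> \<open>At \<open>s = ?c\<close>, \<open>t = - ?b\<close> the form factors as
      \<open>?c\<close> times the Gram determinant.\<close>
    moreover have "0 \<le> ?c * (?a * ?c - ?b\<^sup>2)"
      using quad[of ?c "- ?b"] by (simp add: algebra_simps power2_eq_square)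
    ultimately show ?thesis by (simp add: zero_le_mult_iff)
  qed
qed

text \<open>In use \<open>v\<close> is half of a linear coefficient; this gives both constants their
  shape, half a coefficient plus a root.\<close>

lemma abs_le_of_completed_square:
  fixes u v s S :: real
  assumes "(u + v)\<^sup>2 \<le> S"
  shows "\<bar>u\<bar> \<le> \<bar>v\<bar> + sqrt S"
proof -
  have "\<bar>u + v\<bar> \<le> sqrt S" using real_sqrt_le_mono[OF assms] by simp
  then show ?thesis by linarith
qed

text \<open>The two bounds of the theorem, with \<open>A\<close>, \<open>B\<close> the two quadratic forms, \<open>P\<close>, \<open>Q\<close> the squared
  norms of the corresponding operators and \<open>a\<close> the squared norm of the vector field.\<close>

lemma quadratic_form_bounds:
  fixes lam0 lam1 lam2 lam3 a A B P Q :: real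
  assumes "lam2 > 0" "a \<ge> 0"
    and AP: "A\<^sup>2 \<le> P * a" and BQ: "B\<^sup>2 \<le> Q * a"
    and ineq: "lam0 * A + lam1 * B + P + lam2 * Q \<le> lam3 * a"
  shows "\<bar>B\<bar> \<le> (\<bar>lam1\<bar> / (2 * lam2)
      + sqrt (lam3 / lam2 + lam0\<^sup>2 / (4 * lam2) + (lam1 / (2 * lam2))\<^sup>2)) * a"
    and "\<bar>A\<bar> \<le> (\<bar>lam0\<bar> / 2 + sqrt (lam3 + (lam0 / 2)\<^sup>2 + lam2 * (lam1 / (2 * lam2))\<^sup>2)) * a"
proof -
  have "\<bar>B\<bar> \<le> (\<bar>lam1\<bar> / (2 * lam2)
      + sqrt (lam3 / lam2 + lam0\<^sup>2 / (4 * lam2) + (lam1 / (2 * lam2))\<^sup>2)) * a \<and>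
    \<bar>A\<bar> \<le> (\<bar>lam0\<bar> / 2 + sqrt (lam3 + (lam0 / 2)\<^sup>2 + lam2 * (lam1 / (2 * lam2))\<^sup>2)) * a"
  proof (cases "a = 0")
    case True
    with AP BQ show ?thesis by simp
  next
    case False
    with \<open>a \<ge> 0\<close> have a: "a > 0" by simp
    \<comment> \<open>Dividing by \<open>a\<close> leaves
      \<open>lam0 b + lam1 c + b^2 + lam2 c^2 \<le> lam3\<close>, which confines
      \<open>(b, c)\<close> to an ellipse. The two constants bound its extent in each
      coordinate.\<close>
    define b c where "b = A / a" and "c = B / a"
    have "b\<^sup>2 * a \<le> P" "c\<^sup>2 * a \<le> Q"
      using AP BQ a by (simp_all add: b_def c_def power_divide power2_eq_square field_simps)
    then have "b\<^sup>2 * a \<le> P" "lam2 * (c\<^sup>2 * a) \<le> lam2 * Q"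
      using \<open>lam2 > 0\<close> by (simp_all add: mult_left_mono)
    moreover have "b * a = A" "c * a = B" using a by (simp_all add: b_def c_def)
    ultimately have "lam0 * (b * a) + lam1 * (c * a) + b\<^sup>2 * a + lam2 * (c\<^sup>2 * a) \<le> lam3 * a"
      using ineq by simp
    then have "(lam0 * b + lam1 * c + b\<^sup>2 + lam2 * c\<^sup>2) * a \<le> lam3 * a"
      by (simp add: algebra_simps)
    then have "lam0 * b + lam1 * c + b\<^sup>2 + lam2 * c\<^sup>2 \<le> lam3"
      using a by simp
    moreover have "lam2 * (c + lam1 / (2 * lam2))\<^sup>2
        = lam2 * c\<^sup>2 + lam1 * c + lam2 * (lam1 / (2 * lam2))\<^sup>2"
      using \<open>lam2 > 0\<close> by (simp add: power2_eq_square field_simps)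
    moreover have "(b + lam0 / 2)\<^sup>2 = b\<^sup>2 + lam0 * b + (lam0 / 2)\<^sup>2"
      by (simp add: power2_eq_square field_simps)
    ultimately have main: "(b + lam0 / 2)\<^sup>2 + lam2 * (c + lam1 / (2 * lam2))\<^sup>2
        \<le> lam3 + (lam0 / 2)\<^sup>2 + lam2 * (lam1 / (2 * lam2))\<^sup>2"
      by linarith
    \<comment> \<open>Discarding one of the two nonnegative squares in \<open>main\<close> bounds
      the other; the second constant of the theorem arises here, the first one below after division
      by \<open>lam2\<close>.\<close>
    have "(b + lam0 / 2)\<^sup>2 \<le> lam3 + (lam0 / 2)\<^sup>2 + lam2 * (lam1 / (2 * lam2))\<^sup>2"
      using main mult_nonneg_nonneg[OF less_imp_le[OF \<open>lam2 > 0\<close>] zero_le_power2[of "c + lam1 / (2 * lam2)"]]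
      by linarith
    from abs_le_of_completed_square[OF this]
    have 1: "\<bar>b\<bar> \<le> \<bar>lam0\<bar> / 2 + sqrt (lam3 + (lam0 / 2)\<^sup>2 + lam2 * (lam1 / (2 * lam2))\<^sup>2)"
      by simp
    have "lam2 * (c + lam1 / (2 * lam2))\<^sup>2 \<le> lam3 + (lam0 / 2)\<^sup>2 + lam2 * (lam1 / (2 * lam2))\<^sup>2"
      using main zero_le_power2[of "b + lam0 / 2"] by linarith
    then have "(c + lam1 / (2 * lam2))\<^sup>2
        \<le> (lam3 + (lam0 / 2)\<^sup>2 + lam2 * (lam1 / (2 * lam2))\<^sup>2) / lam2"
      using \<open>lam2 > 0\<close> by (simp add: pos_le_divide_eq mult.commute)
    also have "\<dots> = lam3 / lam2 + lam0\<^sup>2 / (4 * lam2) + (lam1 / (2 * lam2))\<^sup>2"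
      using \<open>lam2 > 0\<close> by (simp add: add_divide_distrib power_divide)
    finally have "\<bar>c\<bar> \<le> \<bar>lam1 / (2 * lam2)\<bar>
        + sqrt (lam3 / lam2 + lam0\<^sup>2 / (4 * lam2) + (lam1 / (2 * lam2))\<^sup>2)"
      by (rule abs_le_of_completed_square)
    then have 2: "\<bar>c\<bar> \<le> \<bar>lam1\<bar> / (2 * lam2)
        + sqrt (lam3 / lam2 + lam0\<^sup>2 / (4 * lam2) + (lam1 / (2 * lam2))\<^sup>2)"
      using \<open>lam2 > 0\<close> by simp
    have "\<bar>A\<bar> = \<bar>b\<bar> * a" "\<bar>B\<bar> = \<bar>c\<bar> * a"
      using a by (simp_all add: b_def c_def)
    then show ?thesis
      using mult_right_mono[OF 1 less_imp_le[OF a]] mult_right_mono[OF 2 less_imp_le[OF a]] by argo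
  qed
  then show "\<bar>B\<bar> \<le> (\<bar>lam1\<bar> / (2 * lam2)
      + sqrt (lam3 / lam2 + lam0\<^sup>2 / (4 * lam2) + (lam1 / (2 * lam2))\<^sup>2)) * a"
    and "\<bar>A\<bar> \<le> (\<bar>lam0\<bar> / 2 + sqrt (lam3 + (lam0 / 2)\<^sup>2 + lam2 * (lam1 / (2 * lam2))\<^sup>2)) * a"
    by blast+
qed

text \<open>Half of \<open>P\<close> absorbs \<open>lam0 * A\<close> and all of
  \<open>lam2 * Q\<close> absorbs \<open>lam1 * B\<close>, each by completing a square at the cost
  of a multiple of \<open>a\<close>. The other half of \<open>P\<close> remains. This controls the
  norm of the image and not only the quadratic form, without appeal to the symmetry of the
  Hessian.\<close>

lemma operator_bound:
  fixes lam0 lam1 lam2 lam3 a A B P Q :: real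
  assumes "lam2 > 0" "a \<ge> 0" "P \<ge> 0" "Q \<ge> 0"
    and AP: "A\<^sup>2 \<le> P * a" and BQ: "B\<^sup>2 \<le> Q * a"
    and ineq: "lam0 * A + lam1 * B + P + lam2 * Q \<le> lam3 * a"
  shows "P \<le> (2 * lam3 + lam0\<^sup>2 + lam1\<^sup>2 / (2 * lam2)) * a"
proof (cases "a = 0")
  case True
  with AP BQ have "A = 0" "B = 0" by simp_all
  moreover have "0 \<le> lam2 * Q" using assms by simp
  ultimately have "P \<le> 0" using True ineq by simp
  with True show ?thesis by simp
next
  case False
  with \<open>a \<ge> 0\<close> have a: "a > 0" by simp
  define p q where "p = A\<^sup>2 / a" and "q = B\<^sup>2 / a"
  have "p \<le> P" "q \<le> Q" using AP BQ a by (simp_all add: p_def q_def divide_le_eq)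
  then have "lam2 * q \<le> lam2 * Q" using \<open>lam2 > 0\<close> by simp
  moreover have "0 \<le> p / 2 + lam0 * A + lam0\<^sup>2 / 2 * a"
  proof -
    have "p / 2 + lam0 * A + lam0\<^sup>2 / 2 * a = (A + lam0 * a)\<^sup>2 / (2 * a)"
      using a by (simp add: p_def power2_eq_square field_simps)
    then show ?thesis using a by simp
  qed
  moreover have "0 \<le> lam2 * q + lam1 * B + lam1\<^sup>2 / (4 * lam2) * a"
  proof -
    have "lam2 * q + lam1 * B + lam1\<^sup>2 / (4 * lam2) * a
        = lam2 * (B + lam1 / (2 * lam2) * a)\<^sup>2 / a"
      using a \<open>lam2 > 0\<close> by (simp add: q_def power2_eq_square field_simps)
    then show ?thesis using a \<open>lam2 > 0\<close> by simp
  qed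
  ultimately have "P / 2 \<le> lam3 * a + lam0\<^sup>2 / 2 * a + lam1\<^sup>2 / (4 * lam2) * a"
    using ineq \<open>p \<le> P\<close> by linarith
  then have "2 * (P / 2) \<le> 2 * (lam3 * a + lam0\<^sup>2 / 2 * a + lam1\<^sup>2 / (4 * lam2) * a)" by simp
  also have "\<dots> = (2 * lam3 + lam0\<^sup>2 + lam1\<^sup>2 / (2 * lam2)) * a"
    using \<open>lam2 > 0\<close> by (simp add: field_simps)
  finally show ?thesis by simp
qed

section \<open>Integrated consequences of anti-monotonicity\<close>

lemma P2_D:
  assumes "\<mu> \<in> P2"
  shows "prob_space \<mu>" "sets \<mu> = sets borel" "space \<mu> = UNIV" "integrable \<mu> (\<lambda>x. (norm x)\<^sup>2)"
  using assms sets_eq_imp_space_eq[of \<mu> borel] by (auto simp: P2_def)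

text \<open>Fubini and pulling \<open>\<xi> x\<close> out of the inner integral rewrite the mixed
  form as an inner product in \<open>L2 \<mu>\<close>, the shape in which Cauchy-Schwarz meets the
  \<open>lam2\<close> term.\<close>

lemma anti_monotone_D:
  fixes G :: "real^'n \<Rightarrow> (real^'n) measure \<Rightarrow> real"
  assumes "anti_monotone lam0 lam1 lam2 lam3 G" "\<mu> \<in> P2" "\<xi> \<in> L2 \<mu>"
  shows "(\<lambda>x. dxx G x \<mu> *v \<xi> x) \<in> L2 \<mu>"
    and "(\<lambda>x. \<integral>y. dxmu G x \<mu> y *v \<xi> y \<partial>\<mu>) \<in> L2 \<mu>"
    and "(\<integral>(x, y). (\<xi> x v* dxmu G x \<mu> y) \<bullet> \<xi> y \<partial>(\<mu> \<Otimes>\<^sub>M \<mu>))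
      = (\<integral>x. \<xi> x \<bullet> (\<integral>y. dxmu G x \<mu> y *v \<xi> y \<partial>\<mu>) \<partial>\<mu>)"
proof -
  interpret prob_space \<mu> using assms(2) by (rule P2_D)
  interpret pair_sigma_finite \<mu> \<mu> ..
  note H = assms(1)[unfolded anti_monotone_def, rule_format, OF assms(2,3)]
  show 1: "(\<lambda>x. dxx G x \<mu> *v \<xi> x) \<in> L2 \<mu>" "(\<lambda>x. \<integral>y. dxmu G x \<mu> y *v \<xi> y \<partial>\<mu>) \<in> L2 \<mu>"
    by (rule H[THEN conjunct1] H[THEN conjunct2, THEN conjunct2, THEN conjunct1])+
  have ae: "AE x in \<mu>. integrable \<mu> (\<lambda>y. dxmu G x \<mu> y *v \<xi> y)"
    by (rule H[THEN conjunct2, THEN conjunct1])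
  have int: "integrable (\<mu> \<Otimes>\<^sub>M \<mu>) (\<lambda>(x, y). (\<xi> x v* dxmu G x \<mu> y) \<bullet> \<xi> y)"
    by (rule H[THEN conjunct2, THEN conjunct2, THEN conjunct2, THEN conjunct1])
  have "(\<integral>(x, y). (\<xi> x v* dxmu G x \<mu> y) \<bullet> \<xi> y \<partial>(\<mu> \<Otimes>\<^sub>M \<mu>))
      = (\<integral>x. (\<integral>y. (\<xi> x v* dxmu G x \<mu> y) \<bullet> \<xi> y \<partial>\<mu>) \<partial>\<mu>)"
    using integral_fst'[OF int] by simp
  also have "\<dots> = (\<integral>x. \<xi> x \<bullet> (\<integral>y. dxmu G x \<mu> y *v \<xi> y \<partial>\<mu>) \<partial>\<mu>)"
  proof (rule integral_cong_AE)
    show "(\<lambda>x. \<integral>y. (\<xi> x v* dxmu G x \<mu> y) \<bullet> \<xi> y \<partial>\<mu>) \<in> borel_measurable \<mu>"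
      using integrable_fst'[OF int] by simp
    show "(\<lambda>x. \<xi> x \<bullet> (\<integral>y. dxmu G x \<mu> y *v \<xi> y \<partial>\<mu>)) \<in> borel_measurable \<mu>"
      using L2_D(1)[OF 1(2)] L2_D(1)[OF assms(3)] by (rule borel_measurable_inner[rotated])
    show "AE x in \<mu>. (\<integral>y. (\<xi> x v* dxmu G x \<mu> y) \<bullet> \<xi> y \<partial>\<mu>) = \<xi> x \<bullet> (\<integral>y. dxmu G x \<mu> y *v \<xi> y \<partial>\<mu>)"
      using ae
    proof eventually_elim
      case (elim x)
      have "\<xi> x \<bullet> (\<integral>y. dxmu G x \<mu> y *v \<xi> y \<partial>\<mu>) = (\<integral>y. \<xi> x \<bullet> (dxmu G x \<mu> y *v \<xi> y) \<partial>\<mu>)"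
        by (rule integral_inner_right[symmetric]) (use elim in auto)
      then show ?case by (simp add: dot_lmul_matrix)
    qed
  qed
  finally show "(\<integral>(x, y). (\<xi> x v* dxmu G x \<mu> y) \<bullet> \<xi> y \<partial>(\<mu> \<Otimes>\<^sub>M \<mu>))
      = (\<integral>x. \<xi> x \<bullet> (\<integral>y. dxmu G x \<mu> y *v \<xi> y \<partial>\<mu>) \<partial>\<mu>)" .
qed

text \<open>The first two bounds are those of the theorem; the third is the source of the pointwise
  bound on \<open>dxx\<close>.\<close>

lemma anti_monotone_bounds:
  fixes G :: "real^'n \<Rightarrow> (real^'n) measure \<Rightarrow> real"
  assumes "lam2 > 0" and anti: "anti_monotone lam0 lam1 lam2 lam3 G" "\<mu> \<in> P2" "\<xi> \<in> L2 \<mu>"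
  shows "\<bar>\<integral>(x, y). (\<xi> x v* dxmu G x \<mu> y) \<bullet> \<xi> y \<partial>(\<mu> \<Otimes>\<^sub>M \<mu>)\<bar>
      \<le> (\<bar>lam1\<bar> / (2 * lam2)
           + sqrt (lam3 / lam2 + lam0\<^sup>2 / (4 * lam2) + (lam1 / (2 * lam2))\<^sup>2))
         * (\<integral>x. (norm (\<xi> x))\<^sup>2 \<partial>\<mu>)"
    and "\<bar>\<integral>x. (dxx G x \<mu> *v \<xi> x) \<bullet> \<xi> x \<partial>\<mu>\<bar>
      \<le> (\<bar>lam0\<bar> / 2 + sqrt (lam3 + (lam0 / 2)\<^sup>2 + lam2 * (lam1 / (2 * lam2))\<^sup>2))
         * (\<integral>x. (norm (\<xi> x))\<^sup>2 \<partial>\<mu>)"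
    and "(\<integral>x. (norm (dxx G x \<mu> *v \<xi> x))\<^sup>2 \<partial>\<mu>)
      \<le> (2 * lam3 + lam0\<^sup>2 + lam1\<^sup>2 / (2 * lam2)) * (\<integral>x. (norm (\<xi> x))\<^sup>2 \<partial>\<mu>)"
proof -
  note D = anti_monotone_D[OF anti]
  have AP: "(\<integral>x. (dxx G x \<mu> *v \<xi> x) \<bullet> \<xi> x \<partial>\<mu>)\<^sup>2
      \<le> (\<integral>x. (norm (dxx G x \<mu> *v \<xi> x))\<^sup>2 \<partial>\<mu>) * (\<integral>x. (norm (\<xi> x))\<^sup>2 \<partial>\<mu>)"
    by (rule Cauchy_Schwarz_L2[OF D(1) anti(3)])
  have BQ: "(\<integral>(x, y). (\<xi> x v* dxmu G x \<mu> y) \<bullet> \<xi> y \<partial>(\<mu> \<Otimes>\<^sub>M \<mu>))\<^sup>2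
      \<le> (\<integral>x. (norm (\<integral>y. dxmu G x \<mu> y *v \<xi> y \<partial>\<mu>))\<^sup>2 \<partial>\<mu>) * (\<integral>x. (norm (\<xi> x))\<^sup>2 \<partial>\<mu>)"
    using Cauchy_Schwarz_L2[OF anti(3) D(2)] by (simp add: D(3) mult.commute)
  have ineq: "lam0 * (\<integral>x. (dxx G x \<mu> *v \<xi> x) \<bullet> \<xi> x \<partial>\<mu>)
          + lam1 * (\<integral>(x, y). (\<xi> x v* dxmu G x \<mu> y) \<bullet> \<xi> y \<partial>(\<mu> \<Otimes>\<^sub>M \<mu>))
          + (\<integral>x. (norm (dxx G x \<mu> *v \<xi> x))\<^sup>2 \<partial>\<mu>)
          + lam2 * (\<integral>x. (norm (\<integral>y. dxmu G x \<mu> y *v \<xi> y \<partial>\<mu>))\<^sup>2 \<partial>\<mu>)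
        \<le> lam3 * (\<integral>x. (norm (\<xi> x))\<^sup>2 \<partial>\<mu>)"
    using anti unfolding anti_monotone_def by blast
  show "\<bar>\<integral>(x, y). (\<xi> x v* dxmu G x \<mu> y) \<bullet> \<xi> y \<partial>(\<mu> \<Otimes>\<^sub>M \<mu>)\<bar>
      \<le> (\<bar>lam1\<bar> / (2 * lam2)
           + sqrt (lam3 / lam2 + lam0\<^sup>2 / (4 * lam2) + (lam1 / (2 * lam2))\<^sup>2))
         * (\<integral>x. (norm (\<xi> x))\<^sup>2 \<partial>\<mu>)"
    and "\<bar>\<integral>x. (dxx G x \<mu> *v \<xi> x) \<bullet> \<xi> x \<partial>\<mu>\<bar>
      \<le> (\<bar>lam0\<bar> / 2 + sqrt (lam3 + (lam0 / 2)\<^sup>2 + lam2 * (lam1 / (2 * lam2))\<^sup>2))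
         * (\<integral>x. (norm (\<xi> x))\<^sup>2 \<partial>\<mu>)"
    and "(\<integral>x. (norm (dxx G x \<mu> *v \<xi> x))\<^sup>2 \<partial>\<mu>)
      \<le> (2 * lam3 + lam0\<^sup>2 + lam1\<^sup>2 / (2 * lam2)) * (\<integral>x. (norm (\<xi> x))\<^sup>2 \<partial>\<mu>)"
    by (rule quadratic_form_bounds[OF \<open>lam2 > 0\<close> _ AP BQ ineq]
          operator_bound[OF \<open>lam2 > 0\<close> _ _ _ AP BQ ineq]; simp)+
qed

section \<open>The Wasserstein space and the chain rule\<close>

lemma distr_in_P2:
  fixes X :: "'w \<Rightarrow> real^'n"
  assumes "prob_space M" "X \<in> L2 M"
  shows "distr M borel X \<in> P2"
proof -
  note X = L2_D[OF assms(2)]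
  have "prob_space (distr M borel X)" using assms(1) X(1) by (rule prob_space.prob_space_distr)
  moreover have "integrable (distr M borel X) (\<lambda>x. (norm x)\<^sup>2)"
    using X by (subst integrable_distr_eq) auto
  ultimately show ?thesis by (simp add: P2_def)
qed

lemma borel_measurable_fst_snd:
  fixes N :: "('a::topological_space \<times> 'b::topological_space) measure"
  assumes "sets N = sets borel"
  shows "fst \<in> borel_measurable N" "snd \<in> borel_measurable N"
  unfolding measurable_cong_sets[OF assms refl]
  by (intro borel_measurable_continuous_onI continuous_intros)+

lemma prob_space_coupling:
  assumes "\<mu> \<in> P2" "\<gamma> \<in> couplings \<mu> \<nu>"
  shows "prob_space \<gamma>"
proof (rule prob_spaceI)
  have s: "sets \<gamma> = sets borel" and d: "distr \<gamma> borel fst = \<mu>"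
    using assms(2) by (auto simp: couplings_def)
  interpret prob_space \<mu> using assms(1) by (rule P2_D)
  have sp: "space \<gamma> = UNIV" using sets_eq_imp_space_eq[OF s] by simp
  have m: "fst \<in> measurable \<gamma> borel" using s by (rule borel_measurable_fst_snd)
  have "emeasure \<mu> UNIV = 1" using emeasure_space_1 P2_D(3)[OF assms(1)] by simp
  then show "emeasure \<gamma> (space \<gamma>) = 1"
    using emeasure_distr[OF m, of UNIV] by (simp add: d sp)
qed

text \<open>The joint law of \<open>X\<close> and \<open>Y\<close> is an admissible coupling. Every
  estimate of \<open>W2\<close> in the proof comes from a pair of random variables in this
  way.\<close>

lemma W2_distr_le:
  fixes X Y :: "'w \<Rightarrow> real^'n"
  assumes X: "X \<in> borel_measurable M" and Y: "Y \<in> borel_measurable M"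
  shows "W2 (distr M borel X) (distr M borel Y) \<le> sqrt (\<integral>w. (norm (X w - Y w))\<^sup>2 \<partial>M)"
proof -
  let ?\<gamma> = "distr M borel (\<lambda>w. (X w, Y w))"
  have m: "(\<lambda>w. (X w, Y w)) \<in> borel_measurable M"
    using X Y by simp
  have "?\<gamma> \<in> couplings (distr M borel X) (distr M borel Y)"
    unfolding couplings_def by (simp add: distr_distr[OF borel_measurable_fst_snd(1)[OF refl] m]
        distr_distr[OF borel_measurable_fst_snd(2)[OF refl] m] comp_def)
  moreover have "bdd_below ((\<lambda>\<gamma>. \<integral>z. (norm (fst z - snd z))\<^sup>2 \<partial>\<gamma>) ` A)"
    for A :: "((real^'n) \<times> (real^'n)) measure set"
    by (intro bdd_belowI2[where m=0]) simp
  ultimately have "(INF \<gamma>\<in>couplings (distr M borel X) (distr M borel Y).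
      \<integral>z. (norm (fst z - snd z))\<^sup>2 \<partial>\<gamma>) \<le> (\<integral>z. (norm (fst z - snd z))\<^sup>2 \<partial>?\<gamma>)"
    by (intro cINF_lower)
  also have "\<dots> = (\<integral>w. (norm (X w - Y w))\<^sup>2 \<partial>M)"
    by (subst integral_distr[OF m])
       (auto intro!: borel_measurable_continuous_onI continuous_intros)
  finally show ?thesis unfolding W2_def by (rule real_sqrt_le_mono)
qed

lemma W2_self:
  assumes "\<mu> \<in> P2"
  shows "W2 \<mu> \<mu> \<le> 0"
proof -
  have m: "(\<lambda>x. x) \<in> borel_measurable \<mu>"
    by (simp add: measurable_cong_sets[OF P2_D(2)[OF assms] refl])
  have "distr \<mu> borel (\<lambda>x. x) = \<mu>"
    using P2_D(2)[OF assms] by (intro distr_id2) auto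
  then show ?thesis using W2_distr_le[OF m m] by simp
qed

text \<open>Convergence of the measures enters through a majorant \<open>b\<close> of the distances,
  since upper bounds for \<open>W2\<close> are what \<open>W2_distr_le\<close> supplies.\<close>

lemma jointly_continuous_tendsto:
  assumes F: "jointly_continuous F" and "\<mu> \<in> P2"
    and x: "(x' \<longlongrightarrow> x) L" and mu: "\<And>n. \<mu>' n \<in> P2"
    and W: "((\<lambda>n. b n) \<longlongrightarrow> 0) L" "\<And>n. W2 (\<mu>' n) \<mu> \<le> (b n :: real)"
  shows "((\<lambda>n. F (x' n) (\<mu>' n)) \<longlongrightarrow> F x \<mu>) L"
proof (rule tendstoI)
  fix e :: real assume "e > 0"
  then obtain d where d: "d > 0"
      "\<And>y \<nu>. \<nu> \<in> P2 \<Longrightarrow> dist y x < d \<and> W2 \<nu> \<mu> < d \<Longrightarrow> dist (F y \<nu>) (F x \<mu>) < e"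
    using F[unfolded jointly_continuous_def, rule_format, OF \<open>\<mu> \<in> P2\<close> \<open>e > 0\<close>, of x] by blast
  have "eventually (\<lambda>n. dist (x' n) x < d) L" using x \<open>d > 0\<close> by (rule tendstoD)
  moreover have "eventually (\<lambda>n. b n < d) L" using W(1) \<open>d > 0\<close> by (rule order_tendstoD)
  ultimately show "eventually (\<lambda>n. dist (F (x' n) (\<mu>' n)) (F x \<mu>) < e) L"
  proof eventually_elim
    case (elim n)
    then show ?case using d(2)[OF mu[of n], of "x' n"] W(2)[of n] by linarith
  qed
qed

lemma jointly_continuous_fixed_measure:
  assumes "jointly_continuous F" "\<mu> \<in> P2"
  shows "continuous_on UNIV (\<lambda>x. F x \<mu>)"
  unfolding continuous_on_def
  using jointly_continuous_tendsto[OF assms, of "\<lambda>y. y" _ _ "\<lambda>_. \<mu>" "\<lambda>_. 0"] assms W2_self by auto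

section \<open>The base space of the lifts, and gradients in the point and in the measure\<close>

lemma Omega_simps [simp]: "space Omega = UNIV" "sets Omega = sets borel"
  by (auto simp: Omega_def)

lemma prob_space_Omega: "prob_space Omega"
  unfolding Omega_def by (intro prob_space_uniform_measure) auto

lemma L2_add:
  fixes f g :: "'w \<Rightarrow> 'b::euclidean_space"
  assumes "f \<in> L2 M" "g \<in> L2 M"
  shows "(\<lambda>w. f w + g w) \<in> L2 M"
proof -
  have "integrable M (\<lambda>w. (norm (f w))\<^sup>2 + 2 * (f w \<bullet> g w) + (norm (g w))\<^sup>2)"
    using integrable_inner_L2[OF assms] L2_D(2)[OF assms(1)] L2_D(2)[OF assms(2)] by simp
  moreover have "(norm (f w + g w))\<^sup>2 = (norm (f w))\<^sup>2 + 2 * (f w \<bullet> g w) + (norm (g w))\<^sup>2" for w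
    by (simp add: power2_norm_eq_inner inner_add_left inner_add_right inner_commute)
  ultimately show ?thesis
    using L2_D(1)[OF assms(1)] L2_D(1)[OF assms(2)] by (simp add: L2_def)
qed

lemma L2_scaleR:
  fixes f :: "'w \<Rightarrow> 'b::euclidean_space"
  assumes "f \<in> L2 M"
  shows "(\<lambda>w. c *\<^sub>R f w) \<in> L2 M"
  using assms by (auto simp: L2_def power_mult_distrib)

text \<open>Riesz representation: the coordinates of the gradient are the values of the derivative
  on \<open>Basis\<close>.\<close>

lemma gderiv_exists:
  fixes f :: "'e::euclidean_space \<Rightarrow> real"
  assumes "f differentiable (at x)"
  shows "\<exists>D. GDERIV f x :> D"
proof -
  obtain f' where f': "(f has_derivative f') (at x)"
    using assms by (auto simp: differentiable_def)
  then interpret bounded_linear f' by (rule has_derivative_bounded_linear)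
  have "f' h = h \<bullet> (\<Sum>b\<in>Basis. f' b *\<^sub>R b)" for h
  proof -
    have "f' h = f' (\<Sum>b\<in>Basis. (h \<bullet> b) *\<^sub>R b)" by (simp only: euclidean_representation)
    also have "\<dots> = (\<Sum>b\<in>Basis. (h \<bullet> b) * f' b)" by (simp add: sum scaleR)
    also have "\<dots> = h \<bullet> (\<Sum>b\<in>Basis. f' b *\<^sub>R b)" by (simp add: inner_sum_right mult_ac)
    finally show ?thesis .
  qed
  then have "f' = (\<lambda>h. h \<bullet> (\<Sum>b\<in>Basis. f' b *\<^sub>R b))" by (rule ext)
  with f' have "GDERIV f x :> (\<Sum>b\<in>Basis. f' b *\<^sub>R b)"
    unfolding gderiv_def by (rule has_derivative_eq_rhs)
  then show ?thesis ..
qed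

lemma gderiv_unique:
  assumes "GDERIV f x :> D" "GDERIV f x :> E"
  shows "D = E"
proof -
  have "(\<lambda>h. h \<bullet> D) = (\<lambda>h. h \<bullet> E)"
    using assms unfolding gderiv_def by (rule has_derivative_unique)
  then have "h \<bullet> D = h \<bullet> E" for h by metis
  then show ?thesis by (metis vector_eq_ldot)
qed

lemma dx_eqI: "GDERIV (\<lambda>y. F y \<mu>) x :> D \<Longrightarrow> dx F x \<mu> = D"
  unfolding dx_def by (rule the_equality) (auto intro: gderiv_unique)

lemma gderiv_dx:
  assumes "fully_C1 F" "\<mu> \<in> P2"
  shows "GDERIV (\<lambda>y. F y \<mu>) x :> dx F x \<mu>"
proof -
  have "(\<lambda>y. F y \<mu>) differentiable (at x)" using assms by (simp add: fully_C1_def)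
  then obtain D where "GDERIV (\<lambda>y. F y \<mu>) x :> D" using gderiv_exists by blast
  then show ?thesis using dx_eqI[of F \<mu> x D] by simp
qed

lemma fully_C1_dmu: "fully_C1 F \<Longrightarrow> is_dmu F (dmu F)"
  using someI_ex[of "is_dmu F"] by (simp add: fully_C1_def dmu_def)

lemma continuous_dx:
  assumes "fully_C1 F" "\<mu> \<in> P2"
  shows "continuous_on UNIV (\<lambda>x. dx F x \<mu>)"
  using assms by (auto simp: fully_C1_def intro: jointly_continuous_fixed_measure)

lemma dmu_measurable:
  fixes F :: "real^'n \<Rightarrow> (real^'n) measure \<Rightarrow> real"
  assumes "fully_C1 F" "\<mu> \<in> P2"
  shows "(\<lambda>y. dmu F x \<mu> y) \<in> borel_measurable borel"
proof -
  have "jointly_continuous (\<lambda>(x, y) \<mu>. dmu F x \<mu> y)"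
    using fully_C1_dmu[OF assms(1)] by (simp add: is_dmu_def)
  from jointly_continuous_fixed_measure[OF this assms(2)]
  have "continuous_on UNIV (\<lambda>p. dmu F (fst p) \<mu> (snd p))" by (simp add: case_prod_beta)
  from continuous_on_compose2[OF this, of UNIV "\<lambda>y. (x, y)"]
  have "continuous_on UNIV (\<lambda>y. dmu F x \<mu> y)" by (simp add: continuous_on_Pair continuous_on_const continuous_on_id)
  then show ?thesis by (rule borel_measurable_continuous_onI)
qed

lemma jointly_continuous_add_fun:
  fixes F :: "'e::metric_space \<Rightarrow> (real^'n) measure \<Rightarrow> 'b::real_normed_vector"
  assumes F: "jointly_continuous F" and g: "continuous_on UNIV g"
  shows "jointly_continuous (\<lambda>x \<mu>. F x \<mu> + g x)"
  unfolding jointly_continuous_def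
proof (intro allI ballI impI)
  fix x and \<mu> :: "(real^'n) measure" and e :: real assume mu: "\<mu> \<in> P2" and "e > 0"
  then have e: "e / 2 > 0" by simp
  obtain d where d: "d > 0"
    "\<And>x' (\<mu>' :: (real^'n) measure). \<mu>' \<in> P2 \<Longrightarrow> dist x' x < d \<and> W2 \<mu>' \<mu> < d \<Longrightarrow> dist (F x' \<mu>') (F x \<mu>) < e / 2"
    using F[unfolded jointly_continuous_def, rule_format, OF mu e, of x] by blast
  obtain d' where d': "d' > 0" "\<And>x'. dist x' x < d' \<Longrightarrow> dist (g x') (g x) < e / 2"
    using g e unfolding continuous_on_iff by (metis UNIV_I)
  show "\<exists>d>0. \<forall>x'. \<forall>\<mu>'\<in>P2. dist x' x < d \<and> W2 \<mu>' \<mu> < d \<longrightarrow>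
      dist (F x' \<mu>' + g x') (F x \<mu> + g x) < e"
  proof (intro exI[of _ "min d d'"] conjI allI ballI impI)
    show "min d d' > 0" using d(1) d'(1) by simp
    fix x' and \<mu>' :: "(real^'n) measure" assume "\<mu>' \<in> P2" "dist x' x < min d d' \<and> W2 \<mu>' \<mu> < min d d'"
    then have "dist (F x' \<mu>') (F x \<mu>) < e / 2" "dist (g x') (g x) < e / 2"
      using d(2) d'(2) by auto
    then show "dist (F x' \<mu>' + g x') (F x \<mu> + g x) < e"
      using dist_triangle_add[of "F x' \<mu>'" "g x'" "F x \<mu>" "g x"] by linarith
  qed
qed

text \<open>The added term does not depend on the measure: it cancels in increments of the lift, so
  \<open>dmu G\<close> remains a Wasserstein gradient.\<close>

lemma fully_C1_add_quadratic:
  fixes G :: "real^'n \<Rightarrow> (real^'n) measure \<Rightarrow> real" and \<alpha> :: real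
  assumes G: "fully_C1 G"
  defines "F \<equiv> \<lambda>x \<mu>. G x \<mu> + \<alpha> / 2 * (norm x)\<^sup>2"
  shows "fully_C1 F" and "\<And>x \<mu>. \<mu> \<in> P2 \<Longrightarrow> dx F x \<mu> = dx G x \<mu> + \<alpha> *\<^sub>R x"
proof -
  have quad: "((\<lambda>x. \<alpha> / 2 * (norm x)\<^sup>2) has_derivative (\<lambda>h. h \<bullet> (\<alpha> *\<^sub>R x))) (at x)" for x :: "real^'n"
    unfolding power2_norm_eq_inner
    by (auto intro!: derivative_eq_intros simp: inner_commute algebra_simps)
  have der: "GDERIV (\<lambda>y. F y \<mu>) x :> dx G x \<mu> + \<alpha> *\<^sub>R x" if "\<mu> \<in> P2" for x \<mu>
    unfolding F_def using gderiv_dx[OF G that, of x] quad[of x]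
    by (intro GDERIV_add) (simp_all add: gderiv_def)
  then show dxF: "dx F x \<mu> = dx G x \<mu> + \<alpha> *\<^sub>R x" if "\<mu> \<in> P2" for x \<mu>
    using that by (intro dx_eqI)
  have "jointly_continuous F"
    unfolding F_def using G
    by (intro jointly_continuous_add_fun continuous_intros) (simp add: fully_C1_def)
  moreover have "(\<lambda>y. F y \<mu>) differentiable (at x)" if "\<mu> \<in> P2" for x \<mu>
    using der[OF that, of x] by (auto simp: gderiv_def differentiable_def)
  \<comment> \<open>The formula for \<open>dx F\<close> is available on \<open>P2\<close> only, and
    joint continuity evaluates nothing outside \<open>P2\<close>.\<close>
  moreover have "jointly_continuous (dx F)"
  proof -
    have "jointly_continuous (\<lambda>x \<mu>. dx G x \<mu> + \<alpha> *\<^sub>R x)"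
      using G by (intro jointly_continuous_add_fun continuous_intros) (simp add: fully_C1_def)
    then show ?thesis by (simp add: jointly_continuous_def dxF)
  qed
  moreover have "is_dmu F (dmu G)"
    using fully_C1_dmu[OF G] by (simp add: is_dmu_def has_wasserstein_gradient_def F_def)
  ultimately show "fully_C1 F" by (auto simp: fully_C1_def)
qed

text \<open>The increment is split into an increment in the point, handled by the mean value theorem and
  joint continuity of \<open>dx F\<close>, and one in the measure, handled by the lift.\<close>

schematic_goal fully_C1_chain_rule:
  fixes F :: "'e::euclidean_space \<Rightarrow> (real^'n) measure \<Rightarrow> real"
  assumes F: "fully_C1 F" and X: "X \<in> L2 Omega" and V: "V \<in> L2 Omega"
  shows "((\<lambda>t. F (x + t *\<^sub>R v) (distr Omega borel (\<lambda>w. X w + t *\<^sub>R V w))) has_real_derivative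
      ?D) (at 0)"
proof -
  interpret prob_space Omega by (rule prob_space_Omega)
  define law where "law t = distr Omega borel (\<lambda>w. X w + t *\<^sub>R V w)" for t :: real
  define N where "N = sqrt (\<integral>w. (norm (V w))\<^sup>2 \<partial>Omega)"
  have N: "N \<ge> 0" by (simp add: N_def)
  have Xt: "(\<lambda>w. X w + t *\<^sub>R V w) \<in> L2 Omega" for t by (intro L2_add L2_scaleR X V)
  have law: "law t \<in> P2" for t unfolding law_def by (rule distr_in_P2[OF prob_space_Omega Xt])
  have law0: "law 0 = distr Omega borel X" by (simp add: law_def)
  have hnorm: "sqrt (\<integral>w. (norm (t *\<^sub>R V w))\<^sup>2 \<partial>Omega) = \<bar>t\<bar> * N" for t
    by (simp add: N_def power_mult_distrib real_sqrt_mult)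
  have W: "W2 (law t) (law 0) \<le> \<bar>t\<bar> * N" for t
    using W2_distr_le[OF L2_D(1)[OF Xt[of t]] L2_D(1)[OF X]] hnorm[of t]
    by (simp add: law_def)
  let ?L = "\<integral>w. dmu F x (law 0) (X w) \<bullet> V w \<partial>Omega"
  have meas: "((\<lambda>t. (F x (law t) - F x (law 0)) / t) \<longlongrightarrow> ?L) (at 0)"
  proof (rule tendstoI)
    fix e :: real assume "e > 0"
    \<comment> \<open>The \<open>+ 1\<close> keeps the denominator positive when the direction
      \<open>V\<close> vanishes almost everywhere.\<close>
    define e' where "e' = e / (2 * (N + 1))"
    have "e' > 0" using \<open>e > 0\<close> N by (simp add: e'_def)
    have "e' * N < e"
    proof -
      have "e' * N \<le> e' * (N + 1)" using \<open>e' > 0\<close> by simp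
      also have "\<dots> = e / 2" using N unfolding e'_def by (simp add: divide_simps)
      finally show ?thesis using \<open>e > 0\<close> by simp
    qed
    have "has_wasserstein_gradient (F x) (dmu F x)"
      using fully_C1_dmu[OF F] by (simp add: is_dmu_def)
    from this[unfolded has_wasserstein_gradient_def, THEN bspec, OF X, THEN conjunct2,
        rule_format, OF \<open>e' > 0\<close>]
    obtain d where "d > 0" and d: "\<And>h. h \<in> L2 Omega \<Longrightarrow>
        sqrt (\<integral>w. (norm (h w))\<^sup>2 \<partial>Omega) < d \<Longrightarrow>
        \<bar>F x (distr Omega borel (\<lambda>w. X w + h w)) - F x (distr Omega borel X)
              - (\<integral>w. dmu F x (distr Omega borel X) (X w) \<bullet> h w \<partial>Omega)\<bar>
           \<le> e' * sqrt (\<integral>w. (norm (h w))\<^sup>2 \<partial>Omega)"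
      by blast
    have "((\<lambda>t. \<bar>t\<bar> * N) \<longlongrightarrow> \<bar>0\<bar> * N) (at (0::real))" by (intro tendsto_intros)
    then have "eventually (\<lambda>t. \<bar>t\<bar> * N < d) (at (0::real))"
      using order_tendstoD(2)[of _ "\<bar>0\<bar> * N" _ d] \<open>d > 0\<close> by simp
    moreover have "eventually (\<lambda>t. t \<noteq> 0) (at (0::real))" by (simp add: eventually_at_filter)
    ultimately show "eventually (\<lambda>t. dist ((F x (law t) - F x (law 0)) / t) ?L < e) (at 0)"
    proof eventually_elim
      case (elim t)
      have "\<bar>F x (law t) - F x (law 0) - t * ?L\<bar> \<le> e' * (\<bar>t\<bar> * N)"
        using d[OF L2_scaleR[OF V, of t]] elim hnorm[of t] by (simp add: law_def)
      then have "\<bar>F x (law t) - F x (law 0) - t * ?L\<bar> / \<bar>t\<bar> \<le> e' * N"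
        using elim by (simp add: pos_divide_le_eq mult_ac)
      moreover have "(F x (law t) - F x (law 0)) / t - ?L = (F x (law t) - F x (law 0) - t * ?L) / t"
        using elim by (simp add: field_simps)
      ultimately show ?case using \<open>e' * N < e\<close> by (simp add: dist_real_def)
    qed
  qed
  \<comment> \<open>Mean value theorem in the point with the measure frozen at \<open>law t\<close>.
    The intermediate point and the measure both vary with \<open>t\<close>, so joint rather than
    separate continuity of \<open>dx F\<close> is used in the limit.\<close>
  have "\<exists>s. \<bar>s\<bar> \<le> \<bar>t\<bar> \<and> F (x + t *\<^sub>R v) (law t) - F x (law t) = t * (v \<bullet> dx F (x + s *\<^sub>R v) (law t))"
    for t
  proof -
    define p where "p r = F (x + r *\<^sub>R (t *\<^sub>R v)) (law t)" for r
    have "(p has_derivative (\<lambda>h. (h *\<^sub>R (t *\<^sub>R v)) \<bullet> dx F (x + r *\<^sub>R (t *\<^sub>R v)) (law t))) (at r)" for r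
    proof -
      have "((\<lambda>y. F y (law t)) has_derivative (\<lambda>h. h \<bullet> dx F (x + r *\<^sub>R (t *\<^sub>R v)) (law t)))
          (at (x + r *\<^sub>R (t *\<^sub>R v)))"
        using gderiv_dx[OF F law] by (simp add: gderiv_def)
      moreover have "((\<lambda>r. x + r *\<^sub>R (t *\<^sub>R v)) has_derivative (\<lambda>h. h *\<^sub>R (t *\<^sub>R v))) (at r)"
        by (auto intro!: derivative_eq_intros)
      ultimately show ?thesis
        unfolding p_def by (rule has_derivative_compose[rotated])
    qed
    then have "DERIV p r :> (t *\<^sub>R v) \<bullet> dx F (x + r *\<^sub>R (t *\<^sub>R v)) (law t)" for r
      unfolding has_field_derivative_def by (rule has_derivative_eq_rhs) (simp add: fun_eq_iff)
    then obtain r where r: "0 < r" "r < 1"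
        "p 1 - p 0 = (1 - 0) * ((t *\<^sub>R v) \<bullet> dx F (x + r *\<^sub>R (t *\<^sub>R v)) (law t))"
      using MVT2[of 0 1 p "\<lambda>r. (t *\<^sub>R v) \<bullet> dx F (x + r *\<^sub>R (t *\<^sub>R v)) (law t)"] by auto
    have "\<bar>r * t\<bar> \<le> \<bar>t\<bar>" using r by (simp add: abs_mult mult_left_le_one_le)
    then show ?thesis using r(3) by (intro exI[of _ "r * t"]) (simp add: p_def)
  qed
  then obtain s where s: "\<bar>s t\<bar> \<le> \<bar>t\<bar>"
      "F (x + t *\<^sub>R v) (law t) - F x (law t) = t * (v \<bullet> dx F (x + s t *\<^sub>R v) (law t))" for t
    by metis
  have "(s \<longlongrightarrow> 0) (at 0)"
  proof (rule tendsto_rabs_zero_cancel, rule tendsto_sandwich)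
    show "((\<lambda>t. 0::real) \<longlongrightarrow> 0) (at (0::real))" "((\<lambda>t. \<bar>t\<bar>) \<longlongrightarrow> 0) (at (0::real))"
      by (auto intro!: tendsto_eq_intros)
  qed (use s in auto)
  then have "((\<lambda>t. x + s t *\<^sub>R v) \<longlongrightarrow> x + 0 *\<^sub>R v) (at 0)"
    by (intro tendsto_intros)
  then have lim_x: "((\<lambda>t. x + s t *\<^sub>R v) \<longlongrightarrow> x) (at 0)" by simp
  have "((\<lambda>t. \<bar>t\<bar> * N) \<longlongrightarrow> \<bar>0\<bar> * N) (at (0::real))" by (intro tendsto_intros)
  then have lim_W: "((\<lambda>t. \<bar>t\<bar> * N) \<longlongrightarrow> 0) (at (0::real))" by simp
  have "jointly_continuous (dx F)" using F by (simp add: fully_C1_def)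
  from jointly_continuous_tendsto[OF this law lim_x law lim_W W]
  have "((\<lambda>t. dx F (x + s t *\<^sub>R v) (law t)) \<longlongrightarrow> dx F x (law 0)) (at 0)" .
  then have "((\<lambda>t. v \<bullet> dx F (x + s t *\<^sub>R v) (law t)) \<longlongrightarrow> v \<bullet> dx F x (law 0)) (at 0)"
    by (intro tendsto_intros)
  moreover have "eventually (\<lambda>t. v \<bullet> dx F (x + s t *\<^sub>R v) (law t)
      = (F (x + t *\<^sub>R v) (law t) - F x (law t)) / t) (at 0)"
    by (simp add: s(2) eventually_at_filter)
  ultimately have "((\<lambda>t. (F (x + t *\<^sub>R v) (law t) - F x (law t)) / t) \<longlongrightarrow> v \<bullet> dx F x (law 0)) (at 0)"
    by (rule Lim_transform_eventually)
  from tendsto_add[OF this meas]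
  have "((\<lambda>t. (F (x + t *\<^sub>R v) (law t) - F x (law 0)) / t)
      \<longlongrightarrow> v \<bullet> dx F x (law 0) + ?L) (at 0)"
    by (simp add: add_divide_distrib[symmetric])
  \<comment> \<open>Here \<open>?D\<close> is instantiated: the gradient in the point paired with
    \<open>v\<close>, plus the Wasserstein gradient integrated against the direction
    \<open>V\<close>.\<close>
  then show "((\<lambda>t. F (x + t *\<^sub>R v) (distr Omega borel (\<lambda>w. X w + t *\<^sub>R V w))) has_real_derivative
      v \<bullet> dx F x (distr Omega borel X)
        + (\<integral>w. dmu F x (distr Omega borel X) (X w) \<bullet> V w \<partial>Omega)) (at 0)"
    unfolding DERIV_def by (simp add: law_def)
qed

section \<open>Finitely supported laws\<close>

text \<open>The values of \<open>s\<close> are coded by natural numbers, the law of the code is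
  realized on the unit interval by its quantile function, and the result is decoded.\<close>

lemma finite_range_realization:
  fixes s :: "'w \<Rightarrow> 'b::euclidean_space"
  assumes "prob_space M" and s: "simple_function M s"
  obtains Z where "Z \<in> borel_measurable Omega" "range Z \<subseteq> s ` space M"
    "distr Omega borel Z = distr M borel s"
proof -
  interpret prob_space M by fact
  define S where "S = s ` space M"
  have S: "finite S" "S \<noteq> {}"
    using simple_functionD(1)[OF s] not_empty by (simp_all add: S_def)
  define k where "k w = real (to_nat_on S (s w))" for w
  have k: "k \<in> borel_measurable M"
    unfolding k_def using simple_function_compose[OF s, of "\<lambda>z. real (to_nat_on S z)"]
    by (simp add: comp_def borel_measurable_simple_function)
  define N where "N = distr M borel k"
  have "real_distribution N" unfolding N_def using k by (rule real_distribution_distr)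
  then interpret N: cdf_distribution N by (simp add: cdf_distribution_def)
  \<comment> \<open>\<open>N.I\<close> is the generalized inverse of the distribution function of
    \<open>N\<close>, used on the open interval only; the value \<open>0\<close> elsewhere is
    arbitrary, as the endpoints are null sets.\<close>
  define J where "J w = (if w \<in> {0<..<1} then N.I w else 0)" for w :: real
  have J: "J \<in> borel_measurable borel"
    unfolding J_def using N.measurable_CI
    by (subst measurable_restrict_space_iff[symmetric]) auto
  then have J': "J \<in> borel_measurable Omega" by (simp add: measurable_cong_sets[OF Omega_simps(2) refl])
  have JN: "distr Omega borel J = N"
  proof (rule measure_eqI)
    show "sets (distr Omega borel J) = sets N" by simp
    fix A assume "A \<in> sets (distr Omega borel J)"
    then have A: "A \<in> sets borel" by simp
    have m: "J -` A \<in> sets borel" using measurable_sets[OF J A] by simp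
    have "emeasure (distr Omega borel J) A = emeasure Omega (J -` A)"
      using A by (simp add: emeasure_distr[OF J'])
    also have "\<dots> = emeasure lborel ({0..1} \<inter> J -` A)"
      using m by (simp add: Omega_def emeasure_uniform_measure divide_ennreal_def)
    also have "\<dots> = emeasure lborel ({0<..<1} \<inter> J -` A)"
    proof (rule emeasure_eq_AE)
      show "AE x in lborel. (x \<in> {0..1} \<inter> J -` A) = (x \<in> {0<..<1} \<inter> J -` A)"
        using AE_lborel_singleton[of 0] AE_lborel_singleton[of 1] by eventually_elim auto
    qed (use m in auto)
    also have "\<dots> = emeasure (restrict_space lborel {0<..<1}) (N.I -` A \<inter> {0<..<1})"
      by (subst emeasure_restrict_space) (auto simp: J_def intro!: arg_cong2[where f=emeasure])
    also have "\<dots> = emeasure (distr (restrict_space lborel {0<..<1}) borel N.I) A"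
      using A N.measurable_CI
      by (subst emeasure_distr)
         (auto simp: space_restrict_space cong: measurable_cong_sets sets_restrict_space_cong)
    also have "\<dots> = emeasure N A" by (simp add: N.distr_I_eq_M)
    finally show "emeasure (distr Omega borel J) A = emeasure N A" .
  qed
  \<comment> \<open>\<open>from_nat_into S\<close> lands in \<open>S\<close> for every argument, so
    the range of \<open>Z\<close> is finite everywhere and not just almost surely.\<close>
  define g where "g r = from_nat_into S (nat \<lfloor>r\<rfloor>)" for r :: real
  have "(\<lambda>r::real. nat \<lfloor>r\<rfloor>) \<in> measurable borel (count_space UNIV)" by measurable
  from measurable_compose[OF this, of "from_nat_into S" borel]
  have g: "g \<in> borel_measurable borel" by (simp add: g_def[abs_def])
  show thesis
  proof (rule that[of "\<lambda>w. g (J w)"])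
    show "(\<lambda>w. g (J w)) \<in> borel_measurable Omega" using measurable_compose[OF J' g] .
    show "range (\<lambda>w. g (J w)) \<subseteq> s ` space M"
      using from_nat_into[OF S(2)] by (auto simp: g_def S_def)
    have "distr Omega borel (\<lambda>w. g (J w)) = distr N borel g"
      using distr_distr[OF g J'] by (simp add: JN comp_def)
    also have "\<dots> = distr M borel (\<lambda>w. g (k w))"
      using distr_distr[OF g k] by (simp add: N_def comp_def)
    also have "\<dots> = distr M borel s"
    proof (rule distr_cong)
      fix w assume "w \<in> space M"
      then have "s w \<in> S" by (simp add: S_def)
      then show "g (k w) = s w" using S by (simp add: g_def k_def countable_finite)
    qed auto
    finally show "distr Omega borel (\<lambda>w. g (J w)) = distr M borel s" .
  qed
qed

text \<open>With integrals written as finite sums with fixed weights, differentiating in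
  \<open>t\<close> below takes only the sum rule.\<close>

lemma integral_finite_range:
  fixes g :: "'z::euclidean_space \<Rightarrow> real"
  assumes "prob_space M" and Z: "Z \<in> borel_measurable M" and fin: "finite (range Z)"
  shows "(\<integral>w. g (Z w) \<partial>M) = (\<Sum>z\<in>range Z. measure M (Z -` {z} \<inter> space M) * g z)"
proof -
  interpret prob_space M by fact
  have m: "Z -` {z} \<inter> space M \<in> sets M" for z using Z by (rule measurable_sets) auto
  have "(\<integral>w. g (Z w) \<partial>M) = (\<integral>w. (\<Sum>z\<in>range Z. indicator (Z -` {z} \<inter> space M) w * g z) \<partial>M)"
  proof (rule Bochner_Integration.integral_cong[OF refl])
    fix w assume "w \<in> space M"
    then have "(\<Sum>z\<in>range Z. indicator (Z -` {z} \<inter> space M) w * g z)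
        = (\<Sum>z\<in>range Z. if z = Z w then g z else 0)"
      by (intro sum.cong) (auto simp: indicator_def)
    then show "g (Z w) = (\<Sum>z\<in>range Z. indicator (Z -` {z} \<inter> space M) w * g z)"
      using fin by simp
  qed
  also have "\<dots> = (\<Sum>z\<in>range Z. measure M (Z -` {z} \<inter> space M) * g z)"
  proof (subst Bochner_Integration.integral_sum)
    show "integrable M (\<lambda>w. indicator (Z -` {z} \<inter> space M) w * g z)" for z
      using m by (intro integrable_mult_left integrable_real_indicator) (simp_all add: emeasure_eq_measure)
  qed (simp add: m)
  finally show ?thesis .
qed

lemma integrable_finite_range:
  fixes g :: "'z::euclidean_space \<Rightarrow> 'b::euclidean_space"
  assumes "prob_space M" and Z: "Z \<in> borel_measurable M" and fin: "finite (range Z)"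
  shows "integrable M (\<lambda>w. g (Z w))"
proof -
  interpret prob_space M by fact
  have "finite (Z ` space M)" using fin by (rule finite_subset[rotated]) auto
  then have "simple_function M Z" using Z by (intro simple_function_borel_measurable) auto
  from simple_function_compose[OF this, of g]
  have "simple_function M (\<lambda>w. g (Z w))" by (simp add: comp_def)
  then have m: "(\<lambda>w. g (Z w)) \<in> borel_measurable M" by (rule borel_measurable_simple_function)
  show ?thesis
  proof (rule integrable_const_bound[OF _ m])
    show "AE w in M. norm (g (Z w)) \<le> (\<Sum>z\<in>range Z. norm (g z))"
      using fin by (auto intro!: member_le_sum)
  qed
qed

lemma fully_C2_dx_component:
  fixes G :: "real^'n \<Rightarrow> (real^'n) measure \<Rightarrow> real"
  assumes "fully_C2 G"
  shows "fully_C1 (\<lambda>x \<mu>. dx G x \<mu> $ i)"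
  using assms by (simp add: fully_C2_def)

lemma dxx_mult_component:
  fixes G :: "real^'n \<Rightarrow> (real^'n) measure \<Rightarrow> real"
  shows "(dxx G x \<mu> *v v) $ i = dx (\<lambda>x \<mu>. dx G x \<mu> $ i) x \<mu> \<bullet> v"
  by (simp add: dxx_def matrix_vector_mul_component)

lemma dxmu_mult_component:
  fixes G :: "real^'n \<Rightarrow> (real^'n) measure \<Rightarrow> real"
  shows "(dxmu G x \<mu> y *v v) $ i = dmu (\<lambda>x \<mu>. dx G x \<mu> $ i) x \<mu> y \<bullet> v"
  by (simp add: dxmu_def matrix_vector_mul_component)

section \<open>Displacement along finitely supported couplings\<close>

text \<open>Along the interpolation \<open>y + t (x - y)\<close> two distinct atoms of a finitely supported coupling
  meet for at most one \<open>t\<close>.  For all other \<open>t\<close> the displacement is a vector field over the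
  interpolated measure, and the integral inequality bounds the derivative.\<close>

lemma finite_coupling_displacement:
  fixes G :: "real^'n \<Rightarrow> (real^'n) measure \<Rightarrow> real"
    and Z :: "real \<Rightarrow> (real^'n) \<times> (real^'n)"
  assumes C2: "fully_C2 G" and anti: "anti_monotone lam0 lam1 lam2 lam3 G"
    and lower: "\<And>\<mu> \<xi>. \<mu> \<in> P2 \<Longrightarrow> \<xi> \<in> L2 \<mu> \<Longrightarrow>
      - \<alpha> * (\<integral>x. (norm (\<xi> x))\<^sup>2 \<partial>\<mu>)
        \<le> (\<integral>x. (dxx G x \<mu> *v \<xi> x) \<bullet> \<xi> x \<partial>\<mu>) + (\<integral>x. \<xi> x \<bullet> (\<integral>y. dxmu G x \<mu> y *v \<xi> y \<partial>\<mu>) \<partial>\<mu>)"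
    and Z: "Z \<in> borel_measurable Omega" and fin: "finite (range Z)"
  shows "- \<alpha> * (\<integral>w. (norm (fst (Z w) - snd (Z w)))\<^sup>2 \<partial>Omega)
    \<le> (\<integral>w. (dx G (fst (Z w)) (distr Omega borel (\<lambda>w. fst (Z w)))
          - dx G (snd (Z w)) (distr Omega borel (\<lambda>w. snd (Z w)))) \<bullet> (fst (Z w) - snd (Z w)) \<partial>Omega)"
proof -
  note pO = prob_space_Omega
  define S where "S = range Z"
  have S: "finite S" using fin by (simp add: S_def)
  define p where "p z = measure Omega (Z -` {z} \<inter> space Omega)" for z
  note sumrep = integral_finite_range[OF pO Z fin, folded S_def p_def]
  define V :: "(real^'n) \<times> (real^'n) \<Rightarrow> real^'n" where "V z = fst z - snd z" for z
  define X where "X t z = snd z + t *\<^sub>R V z" for t z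
  define law where "law t = distr Omega borel (\<lambda>w. X t (Z w))" for t
  define m where "m = (\<integral>w. (norm (V (Z w)))\<^sup>2 \<partial>Omega)"
  have Zfst: "(\<lambda>w. fst (Z w)) \<in> borel_measurable Omega" and Zsnd: "(\<lambda>w. snd (Z w)) \<in> borel_measurable Omega"
    using measurable_compose[OF Z borel_measurable_fst_snd(1)[OF refl]]
      measurable_compose[OF Z borel_measurable_fst_snd(2)[OF refl]] by simp_all
  have mV: "(\<lambda>w. V (Z w)) \<in> borel_measurable Omega" unfolding V_def using Zfst Zsnd by measurable
  have mX: "(\<lambda>w. X t (Z w)) \<in> borel_measurable Omega" for t unfolding X_def using mV Zsnd by measurable
  have VL2: "(\<lambda>w. V (Z w)) \<in> L2 Omega"
    using mV integrable_finite_range[OF pO Z fin, of "\<lambda>z. (norm (V z))\<^sup>2"] by (simp add: L2_def)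
  have XL2: "(\<lambda>w. X t (Z w)) \<in> L2 Omega" for t
    using mX integrable_finite_range[OF pO Z fin, of "\<lambda>z. (norm (X t z))\<^sup>2"] by (simp add: L2_def)
  have law: "law t \<in> P2" for t unfolding law_def by (rule distr_in_P2[OF pO XL2])
  have Xs: "X t z + r *\<^sub>R V z = X (r + t) z" for t r z
    by (simp add: X_def scaleR_add_left add_ac)
  define D where "D i t z = V z \<bullet> dx (\<lambda>x \<mu>. dx G x \<mu> $ i) (X t z) (law t)
      + (\<integral>w. dmu (\<lambda>x \<mu>. dx G x \<mu> $ i) (X t z) (law t) (X t (Z w)) \<bullet> V (Z w) \<partial>Omega)" for i t z
  \<comment> \<open>The chain rule is stated at time \<open>0\<close>; it is applied to the path
    restarted at time \<open>t\<close>, with the atom \<open>z\<close> and the measure moving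
    together.\<close>
  have deriv: "((\<lambda>t. dx G (X t z) (law t) $ i) has_real_derivative D i t z) (at t)" for i t z
  proof -
    have "((\<lambda>r. dx G (X (r + t) z) (law (r + t)) $ i) has_real_derivative D i t z) (at 0)"
      using fully_C1_chain_rule[OF fully_C2_dx_component[OF C2, of i] XL2[of t] VL2, of "X t z" "V z"]
      by (simp add: D_def law_def Xs)
    then show ?thesis
      using DERIV_shift[of "\<lambda>t. dx G (X t z) (law t) $ i" "D i t z" 0 t] by simp
  qed
  \<comment> \<open>\<open>f t\<close> is the integral of \<open>dx G\<close> at the interpolated
    point and measure against the displacement, so \<open>f 1 - f 0\<close> is the right-hand side
    of the claim.\<close>
  define f where "f t = (\<Sum>z\<in>S. p z * (\<Sum>i\<in>UNIV. dx G (X t z) (law t) $ i * V z $ i))" for t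
  define f' where "f' t = (\<Sum>z\<in>S. p z * (\<Sum>i\<in>UNIV. D i t z * V z $ i))" for t
  have f: "(f has_real_derivative f' t) (at t)" for t
    unfolding f_def f'_def by (intro DERIV_sum DERIV_cmult DERIV_cmult_right deriv)
  define T where "T = (\<Union>z\<in>S. \<Union>z'\<in>S - {z}. {t. X t z = X t z'})"
  \<comment> \<open>Two affine paths that agree at two times have the same velocity, hence the same
    starting point, hence come from the same atom.\<close>
  have meet: "finite {t. X t z = X t z'}" if "z \<noteq> z'" for z z'
  proof (rule finite_subset)
    show "{t. X t z = X t z'} \<subseteq> {SOME t. X t z = X t z'}"
    proof
      fix t assume "t \<in> {t. X t z = X t z'}"
      then have t: "X t z = X t z'" by simp
      define r where "r = (SOME t. X t z = X t z')"
      have r: "X r z = X r z'" unfolding r_def using t by (rule someI)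
      have "(t - r) *\<^sub>R V y = X t y - X r y" for y
        by (simp add: X_def scaleR_diff_left)
      then have "(t - r) *\<^sub>R V z = (t - r) *\<^sub>R V z'" by (simp only: t r)
      then have "t = r \<or> V z = V z'" by auto
      moreover have "V z \<noteq> V z'"
      proof
        assume eq: "V z = V z'"
        then have "snd z = snd z'" using t by (simp add: X_def)
        with eq that show False by (auto simp: V_def prod_eq_iff)
      qed
      ultimately show "t \<in> {SOME t. X t z = X t z'}" by (simp add: r_def)
    qed
  qed simp
  have T: "finite T"
    unfolding T_def
  proof (intro finite_UN_I finite_Diff S)
    fix z z' assume "z' \<in> S - {z}"
    then have "z \<noteq> z'" by blast
    then show "finite {t. X t z = X t z'}" by (rule meet)
  qed
  have f'_lower: "- \<alpha> * m \<le> f' t" if "t \<notin> T" for t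
  proof -
    have inj: "X t z = X t z' \<Longrightarrow> z = z'" if "z \<in> S" "z' \<in> S" for z z'
      using that \<open>t \<notin> T\<close> by (auto simp: T_def)
    \<comment> \<open>The Eulerian velocity at time \<open>t\<close>: away from collisions the
      position determines the atom, so \<open>\<xi>\<close> recovers \<open>V z\<close> at
      \<open>X t z\<close>.\<close>
    define \<xi> where "\<xi> x = (\<Sum>z\<in>S. indicator {X t z} x *\<^sub>R V z)" for x
    have xi: "\<xi> (X t z) = V z" if "z \<in> S" for z
    proof -
      have "\<xi> (X t z) = (\<Sum>z'\<in>S. if z' = z then V z' else 0)"
        unfolding \<xi>_def using that by (intro sum.cong) (auto simp: indicator_def dest: inj)
      then show ?thesis using S that by simp
    qed
    have ZS: "Z w \<in> S" for w by (simp add: S_def)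
    have mxi: "\<xi> \<in> borel_measurable borel" unfolding \<xi>_def by measurable
    have borel_law: "borel_measurable (law t) = borel_measurable borel"
      by (intro ext measurable_cong_sets) (simp_all add: law_def)
    have int_law: "(\<integral>x. g x \<partial>law t) = (\<integral>w. g (X t (Z w)) \<partial>Omega)"
      if "g \<in> borel_measurable borel" for g :: "real^'n \<Rightarrow> real"
      unfolding law_def using mX that by (rule integral_distr)
    have integrable_law: "integrable (law t) g"
      if "g \<in> borel_measurable borel" for g :: "real^'n \<Rightarrow> real^'n"
      unfolding law_def using integrable_finite_range[OF pO Z fin, of "\<lambda>z. g (X t z)"] mX that
      by (subst integrable_distr_eq) auto
    have xiL2: "\<xi> \<in> L2 (law t)"
    proof -
      have "integrable (law t) (\<lambda>x. (norm (\<xi> x))\<^sup>2)"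
        unfolding law_def using integrable_finite_range[OF pO Z fin, of "\<lambda>z. (norm (\<xi> (X t z)))\<^sup>2"] mX mxi
        by (subst integrable_distr_eq) auto
      then show ?thesis using mxi by (simp add: L2_def borel_law)
    qed
    define B where "B x = (\<integral>y. dxmu G x (law t) y *v \<xi> y \<partial>law t)" for x
    note anti' = anti_monotone_D[OF anti law xiL2, folded B_def]
    have mA: "(\<lambda>x. dxx G x (law t) *v \<xi> x) \<in> borel_measurable borel"
      and mB: "B \<in> borel_measurable borel"
      using L2_D(1)[OF anti'(1)] L2_D(1)[OF anti'(2)] by (simp_all only: borel_law)
    \<comment> \<open>The rows of \<open>dxmu\<close> are by definition the Wasserstein gradients of
      the components of \<open>dx G\<close>. The measure term of the chain rule is therefore a
      component of \<open>B\<close>, with no exchange of derivatives.\<close>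
    have Bi: "B x $ i = (\<integral>w. dmu (\<lambda>x \<mu>. dx G x \<mu> $ i) x (law t) (X t (Z w)) \<bullet> V (Z w) \<partial>Omega)" for x i
    proof -
      note md = dmu_measurable[OF fully_C2_dx_component[OF C2] law]
      have "(\<lambda>y. dxmu G x (law t) y *v \<xi> y) \<in> borel_measurable borel"
      proof (subst borel_measurable_euclidean_space, intro ballI)
        fix b :: "real^'n" assume "b \<in> Basis"
        then obtain i where b: "b = axis i 1" by (auto simp: Basis_vec_def)
        show "(\<lambda>y. (dxmu G x (law t) y *v \<xi> y) \<bullet> b) \<in> borel_measurable borel"
          unfolding b using md[of i x t] mxi
          by (simp add: inner_axis dxmu_mult_component borel_measurable_inner)
      qed
      from integrable_law[OF this]
      have "B x \<bullet> axis i 1 = (\<integral>y. (dxmu G x (law t) y *v \<xi> y) \<bullet> axis i 1 \<partial>law t)"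
        unfolding B_def by (intro integral_inner_left[symmetric])
      then have "B x $ i = (\<integral>y. dmu (\<lambda>x \<mu>. dx G x \<mu> $ i) x (law t) y \<bullet> \<xi> y \<partial>law t)"
        by (simp add: inner_axis dxmu_mult_component)
      also have "\<dots> = (\<integral>w. dmu (\<lambda>x \<mu>. dx G x \<mu> $ i) x (law t) (X t (Z w)) \<bullet> \<xi> (X t (Z w)) \<partial>Omega)"
        by (rule int_law[OF borel_measurable_inner[OF md mxi]])
      finally show ?thesis by (simp add: xi ZS)
    qed
    have "D i t z = (dxx G (X t z) (law t) *v V z) $ i + B (X t z) $ i" for i z
      by (simp add: D_def Bi dxx_mult_component inner_commute)
    then have "(\<Sum>i\<in>UNIV. D i t z * V z $ i)
        = (dxx G (X t z) (law t) *v V z) \<bullet> V z + V z \<bullet> B (X t z)" for z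
      by (simp add: inner_vec_def algebra_simps sum.distrib)
    then have "f' t = (\<Sum>z\<in>S. p z * ((dxx G (X t z) (law t) *v V z) \<bullet> V z))
        + (\<Sum>z\<in>S. p z * (V z \<bullet> B (X t z)))"
      unfolding f'_def by (simp add: distrib_left sum.distrib)
    also have "\<dots> = (\<integral>w. (dxx G (X t (Z w)) (law t) *v V (Z w)) \<bullet> V (Z w) \<partial>Omega)
        + (\<integral>w. V (Z w) \<bullet> B (X t (Z w)) \<partial>Omega)"
      unfolding sumrep[of "\<lambda>z. (dxx G (X t z) (law t) *v V z) \<bullet> V z"]
        sumrep[of "\<lambda>z. V z \<bullet> B (X t z)"] ..
    also have "\<dots> = (\<integral>x. (dxx G x (law t) *v \<xi> x) \<bullet> \<xi> x \<partial>law t) + (\<integral>x. \<xi> x \<bullet> B x \<partial>law t)"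
      by (simp add: int_law[OF borel_measurable_inner[OF mA mxi]]
          int_law[OF borel_measurable_inner[OF mxi mB]] xi ZS)
    also have "\<dots> \<ge> - \<alpha> * (\<integral>x. (norm (\<xi> x))\<^sup>2 \<partial>law t)"
      unfolding B_def by (rule lower[OF law xiL2])
    also have "(\<integral>x. (norm (\<xi> x))\<^sup>2 \<partial>law t) = m"
      using mxi by (subst int_law) (auto simp: xi ZS m_def)
    finally show ?thesis .
  qed
  \<comment> \<open>The value \<open>0\<close> on the finite set \<open>T\<close> of collision times
    is arbitrary. The gauge integral recovers \<open>f t + \<alpha> * m * t\<close> from its
    derivative off a finite set, so integrability of \<open>f'\<close> comes for free.\<close>
  define h where "h t = (if t \<in> T then 0 else f' t + \<alpha> * m)" for t
  have "(h has_integral (f 1 + \<alpha> * m * 1) - (f 0 + \<alpha> * m * 0)) {0..1}"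
  proof (rule fundamental_theorem_of_calculus_interior_strong[OF T, where f="\<lambda>t. f t + \<alpha> * m * t"])
    have d: "((\<lambda>t. f t + \<alpha> * m * t) has_real_derivative f' t + \<alpha> * m) (at t)" for t
      using f by (auto intro!: derivative_eq_intros)
    then show "continuous_on {0..1} (\<lambda>t. f t + \<alpha> * m * t)"
      by (intro DERIV_continuous_on[where D="\<lambda>t. f' t + \<alpha> * m"]) (rule has_field_derivative_at_within)
    show "((\<lambda>t. f t + \<alpha> * m * t) has_vector_derivative h t) (at t)" if "t \<in> {0<..<1} - T" for t
      using d[of t] that by (simp add: h_def has_real_derivative_iff_has_vector_derivative)
  qed simp
  moreover have "0 \<le> h t" for t using f'_lower[of t] by (cases "t \<in> T") (auto simp: h_def)
  ultimately have "0 \<le> (f 1 + \<alpha> * m * 1) - (f 0 + \<alpha> * m * 0)"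
    by (rule has_integral_nonneg)
  then have le: "- \<alpha> * m \<le> f 1 - f 0" by simp
  have f_inner: "f t = (\<Sum>z\<in>S. p z * (dx G (X t z) (law t) \<bullet> V z))" for t
    by (simp add: f_def inner_vec_def)
  have X_ends: "X 1 z = fst z" "X 0 z = snd z" for z by (simp_all add: X_def V_def)
  have "f 1 - f 0 = (\<integral>w. (dx G (fst (Z w)) (law 1) - dx G (snd (Z w)) (law 0)) \<bullet> V (Z w) \<partial>Omega)"
    unfolding sumrep[of "\<lambda>z. (dx G (fst z) (law 1) - dx G (snd z) (law 0)) \<bullet> V z"]
    by (simp add: f_inner X_ends inner_diff_left right_diff_distrib sum_subtractf)
  with le show ?thesis by (simp add: law_def X_def V_def m_def)
qed

section \<open>Lipschitz bound for the gradient\<close>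

text \<open>The integral inequality controls \<open>dxx G x \<mu>\<close> only for \<open>\<mu>\<close>-almost every \<open>x\<close>.  For the other
  points an atom at \<open>x\<close> of vanishing mass is added to \<open>\<mu>\<close>.\<close>

schematic_goal dxx_bounded:
  fixes G :: "real^'n \<Rightarrow> (real^'n) measure \<Rightarrow> real"
  assumes "lam2 > 0" and C2: "fully_C2 G" and anti: "anti_monotone lam0 lam1 lam2 lam3 G"
    and mu: "\<mu> \<in> P2"
  shows "norm (dxx G x \<mu> *v v) \<le> ?C * norm v"
proof -
  define K where "K = 2 * lam3 + lam0\<^sup>2 + lam1\<^sup>2 / (2 * lam2)"
  define M where "M = \<mu> \<Otimes>\<^sub>M Omega"
  interpret mu: prob_space \<mu> using mu by (rule P2_D)
  interpret Om: prob_space Omega by (rule prob_space_Omega)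
  interpret pair_prob_space \<mu> Omega ..
  have pM: "prob_space M" unfolding M_def by (rule P.prob_space_axioms)
  have borel_mu [measurable_cong]: "sets \<mu> = sets borel" using mu by (rule P2_D)
  have [measurable_cong]: "sets Omega = sets borel" by simp
  have spM: "space M = UNIV" using P2_D(3)[OF mu] by (simp add: M_def space_pair_measure)
  define e :: "nat \<Rightarrow> real" where "e n = 1 / real (Suc n)" for n
  have e: "0 < e n" "e n \<le> 1" for n by (auto simp: e_def)
  \<comment> \<open>On a slice of mass \<open>e n\<close>, independent of the first coordinate, the
    point is replaced by \<open>x\<close>: the law of \<open>T n\<close> is
    \<open>(1 - e n) \<mu>\<close> plus mass \<open>e n\<close> at \<open>x\<close>. Because of
    \<open>0 < snd p\<close>, every fixed \<open>p\<close> is eventually left unchanged.\<close>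
  define T where "T n p = (if 0 < snd p \<and> snd p \<le> e n then x else fst p)" for n p
  have mfst [measurable]: "fst \<in> borel_measurable M" unfolding M_def by measurable
  have msnd [measurable]: "snd \<in> borel_measurable M" unfolding M_def by measurable
  have T [measurable]: "T n \<in> borel_measurable M" for n unfolding T_def by measurable
  have dfst: "distr M borel fst = \<mu>"
  proof -
    have "distr M borel fst = distr (\<mu> \<Otimes>\<^sub>M Omega) \<mu> fst"
      unfolding M_def by (rule distr_cong) (simp_all add: borel_mu)
    then show ?thesis by (simp add: Om.distr_pair_fst)
  qed
  have sq: "integrable M (\<lambda>p. (norm (fst p))\<^sup>2)"
    using P2_D(4)[OF mu] unfolding dfst[symmetric] by (subst (asm) integrable_distr_eq) auto
  then have dom: "integrable M (\<lambda>p. 2 * ((norm (fst p))\<^sup>2 + (norm x)\<^sup>2))"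
  proof -
    interpret M: prob_space M by (rule pM)
    show ?thesis using sq by simp
  qed
  have sq_sum: "(norm (a - b))\<^sup>2 \<le> 2 * ((norm a)\<^sup>2 + (norm b)\<^sup>2)" for a b :: "real^'n"
  proof -
    have "0 \<le> (norm (a + b))\<^sup>2" by simp
    then show ?thesis
      unfolding power2_norm_eq_inner
      by (simp add: inner_add_left inner_add_right inner_diff_left inner_diff_right inner_commute)
  qed
  have TL2: "T n \<in> L2 M" for n
  proof -
    have "integrable M (\<lambda>p. (norm (T n p))\<^sup>2)"
      by (rule Bochner_Integration.integrable_bound[OF dom]) (auto simp: T_def)
    then show ?thesis by (simp add: L2_def)
  qed
  define \<mu>' where "\<mu>' n = distr M borel (T n)" for n
  have mu': "\<mu>' n \<in> P2" for n unfolding \<mu>'_def using pM TL2 by (rule distr_in_P2)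
  have "(\<lambda>n. \<integral>p. (norm (T n p - fst p))\<^sup>2 \<partial>M) \<longlonglongrightarrow> (\<integral>p. 0 \<partial>M)"
  proof (rule integral_dominated_convergence[OF _ _ dom])
    show "AE p in M. (\<lambda>n. (norm (T n p - fst p))\<^sup>2) \<longlonglongrightarrow> 0"
    proof (intro AE_I2 tendsto_eventually)
      fix p :: "(real^'n) \<times> real"
      show "\<forall>\<^sub>F n in sequentially. (norm (T n p - fst p))\<^sup>2 = 0"
      proof (cases "0 < snd p")
        case True
        have "e \<longlonglongrightarrow> 0" unfolding e_def using LIMSEQ_inverse_real_of_nat by (simp add: inverse_eq_divide)
        then have "\<forall>\<^sub>F n in sequentially. e n < snd p" using True by (rule order_tendstoD)
        then show ?thesis by eventually_elim (auto simp: T_def)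
      qed (simp add: T_def)
    qed
    show "AE p in M. norm ((norm (T n p - fst p))\<^sup>2) \<le> 2 * ((norm (fst p))\<^sup>2 + (norm x)\<^sup>2)" for n
      using sq_sum by (auto simp: T_def norm_minus_commute add.commute)
  qed auto
  from tendsto_real_sqrt[OF this]
  have Wlim: "(\<lambda>n. sqrt (\<integral>p. (norm (T n p - fst p))\<^sup>2 \<partial>M)) \<longlonglongrightarrow> 0" by simp
  have W: "W2 (\<mu>' n) \<mu> \<le> sqrt (\<integral>p. (norm (T n p - fst p))\<^sup>2 \<partial>M)" for n
    using W2_distr_le[OF T mfst, of n] by (simp add: dfst \<mu>'_def)
  have bound: "norm (dxx G x (\<mu>' n) *v v) \<le> sqrt K * norm v" for n
  proof -
    interpret mu': prob_space "\<mu>' n" using mu' by (rule P2_D)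
    have sets': "sets (\<mu>' n) = sets borel" by (simp add: \<mu>'_def)
    have atom: "measure (\<mu>' n) {x} > 0"
    proof -
      have "emeasure M (UNIV \<times> {0<..e n}) = emeasure \<mu> UNIV * emeasure Omega {0<..e n}"
        unfolding M_def by (rule Om.emeasure_pair_measure_Times) (auto simp: borel_mu)
      also have "\<dots> = ennreal (e n)"
      proof -
        have "{0..1} \<inter> {0<..e n} = {0<..e n}" using e[of n] by auto
        then show ?thesis using mu.emeasure_space_1 P2_D(3)[OF mu] e[of n]
          by (simp add: Omega_def emeasure_uniform_measure divide_ennreal_def)
      qed
      finally have "ennreal (e n) = emeasure M (UNIV \<times> {0<..e n})" ..
      also have "\<dots> \<le> emeasure M (T n -` {x} \<inter> space M)"
        using measurable_sets[OF T, of "{x}" n] by (intro emeasure_mono) (auto simp: T_def spM)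
      also have "\<dots> = emeasure (\<mu>' n) {x}" unfolding \<mu>'_def by (subst emeasure_distr) auto
      finally have "ennreal (e n) \<le> ennreal (measure (\<mu>' n) {x})"
        by (simp add: mu'.emeasure_eq_measure)
      then show ?thesis using e[of n] by (simp add: ennreal_le_iff)
    qed
    \<comment> \<open>A field supported in the atom: both sides of the integrated bound become
      multiples of the mass of \<open>{x}\<close>, which is positive and cancels.\<close>
    let ?\<xi> = "\<lambda>y. indicator {x} y *\<^sub>R v"
    have int: "(\<integral>y. c * indicator {x} y \<partial>\<mu>' n) = c * measure (\<mu>' n) {x}" for c :: real
      by (simp add: sets')
    have ind2: "(norm (indicator {x} y *\<^sub>R w))\<^sup>2 = (norm w)\<^sup>2 * indicator {x} y" for w :: "real^'n" and y
      by (simp add: indicator_def)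
    have "integrable (\<mu>' n) (\<lambda>y. (norm (?\<xi> y))\<^sup>2)"
      unfolding ind2 using sets' by (simp add: mu'.emeasure_eq_measure)
    moreover have "?\<xi> \<in> borel_measurable (\<mu>' n)"
      using sets' by (intro borel_measurable_scaleR borel_measurable_indicator) auto
    ultimately have "?\<xi> \<in> L2 (\<mu>' n)" unfolding L2_def by blast
    from anti_monotone_bounds(3)[OF \<open>lam2 > 0\<close> anti mu' this]
    have "(\<integral>y. (norm (dxx G y (\<mu>' n) *v ?\<xi> y))\<^sup>2 \<partial>\<mu>' n) \<le> K * (\<integral>y. (norm (?\<xi> y))\<^sup>2 \<partial>\<mu>' n)"
      by (simp add: K_def)
    also have "(\<integral>y. (norm (dxx G y (\<mu>' n) *v ?\<xi> y))\<^sup>2 \<partial>\<mu>' n)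
        = (\<integral>y. (norm (dxx G x (\<mu>' n) *v v))\<^sup>2 * indicator {x} y \<partial>\<mu>' n)"
      by (intro Bochner_Integration.integral_cong refl) (auto simp: indicator_def)
    finally have "(norm (dxx G x (\<mu>' n) *v v))\<^sup>2 * measure (\<mu>' n) {x}
        \<le> K * (norm v)\<^sup>2 * measure (\<mu>' n) {x}"
      by (simp only: ind2 int mult.assoc)
    then have "(norm (dxx G x (\<mu>' n) *v v))\<^sup>2 \<le> K * (norm v)\<^sup>2"
      using atom by simp
    from real_sqrt_le_mono[OF this] show ?thesis by (simp add: real_sqrt_mult)
  qed
  have "(\<lambda>n. dxx G x (\<mu>' n) *v v) \<longlonglongrightarrow> dxx G x \<mu> *v v"
  proof (rule vec_tendstoI)
    fix i
    have "jointly_continuous (dx (\<lambda>x \<mu>. dx G x \<mu> $ i))"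
      using fully_C2_dx_component[OF C2, of i] by (simp add: fully_C1_def)
    from jointly_continuous_tendsto[OF this mu tendsto_const mu' Wlim W]
    have "(\<lambda>n. dx (\<lambda>x \<mu>. dx G x \<mu> $ i) x (\<mu>' n)) \<longlonglongrightarrow> dx (\<lambda>x \<mu>. dx G x \<mu> $ i) x \<mu>" .
    then show "(\<lambda>n. (dxx G x (\<mu>' n) *v v) $ i) \<longlonglongrightarrow> (dxx G x \<mu> *v v) $ i"
      unfolding dxx_mult_component by (intro tendsto_intros)
  qed
  \<comment> \<open>The bound does not depend on \<open>n\<close>, so it survives the limit and
    fixes \<open>?C\<close>.\<close>
  then show "norm (dxx G x \<mu> *v v) \<le> sqrt (2 * lam3 + lam0\<^sup>2 + lam1\<^sup>2 / (2 * lam2)) * norm v"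
    unfolding K_def[symmetric] by (intro tendsto_upperbound[OF tendsto_norm]) (use bound in auto)
qed

\<comment> \<open>Mean value inequality with the operator bound on \<open>dxx\<close>. The constant
  depends on the \<open>lam\<close> parameters alone; its uniformity in the measure is what
  dominated convergence along varying marginals requires.\<close>
schematic_goal dx_lipschitz:
  fixes G :: "real^'n \<Rightarrow> (real^'n) measure \<Rightarrow> real"
  assumes "lam2 > 0" and C2: "fully_C2 G" and anti: "anti_monotone lam0 lam1 lam2 lam3 G"
    and mu: "\<mu> \<in> P2"
  shows "norm (dx G x \<mu> - dx G y \<mu>) \<le> ?C * norm (x - y)"
proof -
  have "((\<lambda>x. dx G x \<mu>) has_derivative (\<lambda>h. dxx G x \<mu> *v h)) (at x)" for x
  proof (subst has_derivative_componentwise_within, intro ballI)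
    fix b :: "real^'n" assume "b \<in> Basis"
    then obtain i where b: "b = axis i 1" by (auto simp: Basis_vec_def)
    have "((\<lambda>x. dx G x \<mu> $ i) has_derivative (\<lambda>h. (dxx G x \<mu> *v h) $ i)) (at x)"
      using gderiv_dx[OF fully_C2_dx_component[OF C2] mu, of i x]
      by (simp add: gderiv_def dxx_mult_component inner_commute)
    then show "((\<lambda>x. dx G x \<mu> \<bullet> b) has_derivative (\<lambda>h. (dxx G x \<mu> *v h) \<bullet> b)) (at x)"
      by (simp add: b inner_axis)
  qed
  moreover have "onorm (\<lambda>h. dxx G x \<mu> *v h)
      \<le> sqrt (2 * lam3 + lam0\<^sup>2 + lam1\<^sup>2 / (2 * lam2))" for x
    by (rule onorm_le) (rule dxx_bounded[OF \<open>lam2 > 0\<close> C2 anti mu])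
  ultimately show "norm (dx G x \<mu> - dx G y \<mu>)
      \<le> sqrt (2 * lam3 + lam0\<^sup>2 + lam1\<^sup>2 / (2 * lam2)) * norm (x - y)"
    by (intro differentiable_bound[of UNIV "\<lambda>x. dx G x \<mu>" "\<lambda>x h. dxx G x \<mu> *v h"]) auto
qed

section \<open>General couplings\<close>

\<comment> \<open>Both integrability claims are stated because displacement monotonicity demands an
  existing integral. \<open>?alpha\<close> becomes the sum of the two constants of the
  theorem.\<close>
schematic_goal coupling_displacement:
  fixes G :: "real^'n \<Rightarrow> (real^'n) measure \<Rightarrow> real"
  assumes "lam2 > 0" and C2: "fully_C2 G" and anti: "anti_monotone lam0 lam1 lam2 lam3 G"
    and mu: "\<mu> \<in> P2" and nu: "\<nu> \<in> P2" and gam: "\<gamma> \<in> couplings \<mu> \<nu>"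
  shows "integrable \<gamma> (\<lambda>z. (norm (fst z - snd z))\<^sup>2)"
    and "integrable \<gamma> (\<lambda>z. (dx G (fst z) \<mu> - dx G (snd z) \<nu>) \<bullet> (fst z - snd z))"
    and "- ?alpha * (\<integral>z. (norm (fst z - snd z))\<^sup>2 \<partial>\<gamma>)
      \<le> (\<integral>z. (dx G (fst z) \<mu> - dx G (snd z) \<nu>) \<bullet> (fst z - snd z) \<partial>\<gamma>)"
proof -
  let ?a = "(\<bar>lam1\<bar> / (2 * lam2)
      + sqrt (lam3 / lam2 + lam0\<^sup>2 / (4 * lam2) + (lam1 / (2 * lam2))\<^sup>2))
    + (\<bar>lam0\<bar> / 2 + sqrt (lam3 + (lam0 / 2)\<^sup>2 + lam2 * (lam1 / (2 * lam2))\<^sup>2))"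
  have lower: "- ?a * (\<integral>x. (norm (\<xi> x))\<^sup>2 \<partial>\<mu>)
      \<le> (\<integral>x. (dxx G x \<mu> *v \<xi> x) \<bullet> \<xi> x \<partial>\<mu>) + (\<integral>x. \<xi> x \<bullet> (\<integral>y. dxmu G x \<mu> y *v \<xi> y \<partial>\<mu>) \<partial>\<mu>)"
    if "\<mu> \<in> P2" "\<xi> \<in> L2 \<mu>" for \<mu> \<xi>
    using anti_monotone_bounds(1,2)[OF \<open>lam2 > 0\<close> anti that]
    unfolding anti_monotone_D(3)[OF anti that] mult_minus_left distrib_right by linarith
  have sets: "sets \<gamma> = sets borel" and dfst: "distr \<gamma> borel fst = \<mu>" and dsnd: "distr \<gamma> borel snd = \<nu>"
    using gam by (auto simp: couplings_def)
  have space: "space \<gamma> = UNIV" using sets_eq_imp_space_eq[OF sets] by simp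
  have p\<gamma>: "prob_space \<gamma>" using mu gam by (rule prob_space_coupling)
  then interpret prob_space \<gamma> .
  have C1: "fully_C1 G" using C2 by (simp add: fully_C2_def)
  note mfs = borel_measurable_fst_snd[OF sets] borel_measurable_fst_snd[OF refl]
  have borel_\<gamma>: "borel_measurable \<gamma> = borel_measurable borel"
    by (intro ext measurable_cong_sets sets refl)
  have sq: "integrable \<gamma> (\<lambda>z. (norm z)\<^sup>2)"
  proof -
    have "integrable \<gamma> (\<lambda>z. (norm (fst z))\<^sup>2)"
      using P2_D(4)[OF mu] integrable_distr_eq[OF mfs(1), of "\<lambda>x. (norm x)\<^sup>2"] by (simp add: dfst)
    moreover have "integrable \<gamma> (\<lambda>z. (norm (snd z))\<^sup>2)"
      using P2_D(4)[OF nu] integrable_distr_eq[OF mfs(2), of "\<lambda>x. (norm x)\<^sup>2"] by (simp add: dsnd)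
    moreover have "(norm z)\<^sup>2 = (norm (fst z))\<^sup>2 + (norm (snd z))\<^sup>2" for z :: "(real^'n) \<times> (real^'n)"
      by (simp add: norm_prod_def)
    ultimately show ?thesis by simp
  qed
  \<comment> \<open>Simple approximations of the identity, with base point \<open>0\<close>: the
    factor \<open>2\<close> yields domination by the second moment of
    \<open>\<gamma>\<close>.\<close>
  obtain s where s: "\<And>n. simple_function \<gamma> (s n)"
    and s_lim: "\<And>z. (\<lambda>n. s n z) \<longlonglongrightarrow> z"
    and s_le: "\<And>n z. norm (s n z) \<le> 2 * norm z"
  proof -
    have "(\<lambda>z. z) \<in> borel_measurable \<gamma>" by (simp add: borel_\<gamma>)
    from borel_measurable_implies_sequence_metric[OF this, of 0] show thesis
      using that by (auto simp: space)
  qed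
  have ms: "s n \<in> borel_measurable \<gamma>" for n using s by (rule borel_measurable_simple_function)
  define \<mu>' \<nu>' where "\<mu>' n = distr \<gamma> borel (\<lambda>z. fst (s n z))"
    and "\<nu>' n = distr \<gamma> borel (\<lambda>z. snd (s n z))" for n
  note mfst = measurable_compose[OF ms mfs(3)] and msnd = measurable_compose[OF ms mfs(4)]
  have norm_fs: "norm (fst z) \<le> norm z" "norm (snd z) \<le> norm z" for z :: "(real^'n) \<times> (real^'n)"
    using norm_fst_le norm_snd_le by (metis prod.collapse)+
  have L2: "(\<lambda>z. fst (s n z)) \<in> L2 \<gamma>" "(\<lambda>z. snd (s n z)) \<in> L2 \<gamma>" for n
  proof -
    have dom: "integrable \<gamma> (\<lambda>z. 4 * (norm z)\<^sup>2)" using sq by simp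
    have "(norm (fst (s n z)))\<^sup>2 \<le> 4 * (norm z)\<^sup>2" "(norm (snd (s n z)))\<^sup>2 \<le> 4 * (norm z)\<^sup>2" for z
    proof -
      have "norm (fst (s n z)) \<le> 2 * norm z" "norm (snd (s n z)) \<le> 2 * norm z"
        using norm_fs[of "s n z"] s_le[of n z] by linarith+
      from this[THEN power_mono[where n=2]]
      show "(norm (fst (s n z)))\<^sup>2 \<le> 4 * (norm z)\<^sup>2" "(norm (snd (s n z)))\<^sup>2 \<le> 4 * (norm z)\<^sup>2"
        by (simp_all add: power_mult_distrib)
    qed
    then have "integrable \<gamma> (\<lambda>z. (norm (fst (s n z)))\<^sup>2)" "integrable \<gamma> (\<lambda>z. (norm (snd (s n z)))\<^sup>2)"
      using mfst[of n] msnd[of n]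
      by (intro Bochner_Integration.integrable_bound[OF dom] borel_measurable_power
          borel_measurable_norm AE_I2; simp)+
    then show "(\<lambda>z. fst (s n z)) \<in> L2 \<gamma>" "(\<lambda>z. snd (s n z)) \<in> L2 \<gamma>"
      using mfst[of n] msnd[of n] by (simp_all add: L2_def)
  qed
  have mu': "\<mu>' n \<in> P2" and nu': "\<nu>' n \<in> P2" for n
    unfolding \<mu>'_def \<nu>'_def by (intro distr_in_P2 p\<gamma> L2)+
  have diff_le: "norm (s n z - z) \<le> 3 * norm z" for n z
    using norm_triangle_ineq4[of "s n z" z] s_le[of n z] by linarith
  \<comment> \<open>One majorant serves both marginals, since the two projections are
    1-Lipschitz.\<close>
  define b where "b n = sqrt (\<integral>z. (norm (s n z - z))\<^sup>2 \<partial>\<gamma>)" for n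
  have sq_diff: "\<And>n. integrable \<gamma> (\<lambda>z. (norm (s n z - z))\<^sup>2)"
    and b_lim: "b \<longlonglongrightarrow> 0"
  proof -
    have dom: "integrable \<gamma> (\<lambda>z. 9 * (norm z)\<^sup>2)" using sq by simp
    have m: "(\<lambda>z. (norm (s n z - z))\<^sup>2) \<in> borel_measurable \<gamma>" for n
      using ms[of n] by (simp add: borel_\<gamma>)
    have le: "(norm (s n z - z))\<^sup>2 \<le> 9 * (norm z)\<^sup>2" for n z
      using power_mono[OF diff_le[of n z], of 2] by (simp add: power_mult_distrib)
    show "integrable \<gamma> (\<lambda>z. (norm (s n z - z))\<^sup>2)" for n
      using le by (intro Bochner_Integration.integrable_bound[OF dom m]) auto
    have "(\<lambda>n. \<integral>z. (norm (s n z - z))\<^sup>2 \<partial>\<gamma>) \<longlonglongrightarrow> (\<integral>z. 0 \<partial>\<gamma>)"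
    proof (rule integral_dominated_convergence[OF _ m dom])
      show "AE z in \<gamma>. (\<lambda>n. (norm (s n z - z))\<^sup>2) \<longlonglongrightarrow> 0"
      proof (rule AE_I2)
        fix z
        have "(\<lambda>n. (norm (s n z - z))\<^sup>2) \<longlonglongrightarrow> (norm (z - z))\<^sup>2" by (intro tendsto_intros s_lim)
        then show "(\<lambda>n. (norm (s n z - z))\<^sup>2) \<longlonglongrightarrow> 0" by simp
      qed
    qed (use le in auto)
    from tendsto_real_sqrt[OF this] show "b \<longlonglongrightarrow> 0" by (simp add: b_def[abs_def])
  qed
  have W: "W2 (\<mu>' n) \<mu> \<le> b n" "W2 (\<nu>' n) \<nu> \<le> b n" for n
  proof -
    have le: "(norm (fst (s n z) - fst z))\<^sup>2 \<le> (norm (s n z - z))\<^sup>2"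
        "(norm (snd (s n z) - snd z))\<^sup>2 \<le> (norm (s n z - z))\<^sup>2" for z
      using norm_fs[of "s n z - z"] by (simp_all add: power_mono)
    then have int: "integrable \<gamma> (\<lambda>z. (norm (fst (s n z) - fst z))\<^sup>2)"
        "integrable \<gamma> (\<lambda>z. (norm (snd (s n z) - snd z))\<^sup>2)"
      using mfst[of n] msnd[of n] mfs(1,2)
      by (intro Bochner_Integration.integrable_bound[OF sq_diff[of n]] borel_measurable_power
          borel_measurable_norm borel_measurable_diff AE_I2; simp)+
    have "sqrt (\<integral>z. (norm (fst (s n z) - fst z))\<^sup>2 \<partial>\<gamma>) \<le> b n"
      unfolding b_def using le(1) int(1) sq_diff[of n] by (intro real_sqrt_le_mono integral_mono) auto
    with W2_distr_le[OF mfst[of n] mfs(1)] show "W2 (\<mu>' n) \<mu> \<le> b n"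
      by (simp add: \<mu>'_def dfst)
    have "sqrt (\<integral>z. (norm (snd (s n z) - snd z))\<^sup>2 \<partial>\<gamma>) \<le> b n"
      unfolding b_def using le(2) int(2) sq_diff[of n] by (intro real_sqrt_le_mono integral_mono) auto
    with W2_distr_le[OF msnd[of n] mfs(2)] show "W2 (\<nu>' n) \<nu> \<le> b n"
      by (simp add: \<nu>'_def dsnd)
  qed

  define I where "I m k z = (dx G (fst z) m - dx G (snd z) k) \<bullet> (fst z - snd z)" for m k z
  define N where "N z = (norm (fst z - snd z))\<^sup>2" for z :: "(real^'n) \<times> (real^'n)"
  have mI: "I m k \<in> borel_measurable borel" if "m \<in> P2" "k \<in> P2" for m k
    unfolding I_def
    by (intro borel_measurable_continuous_onI continuous_intros
        continuous_on_compose2[OF continuous_dx[OF C1 that(1)]]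
        continuous_on_compose2[OF continuous_dx[OF C1 that(2)]]) auto
  have mN: "N \<in> borel_measurable borel"
    unfolding N_def by (intro borel_measurable_continuous_onI continuous_intros)
  have int_norm: "integrable \<gamma> (\<lambda>z. norm z)"
  proof (rule Bochner_Integration.integrable_bound)
    show "integrable \<gamma> (\<lambda>z. 1 + (norm z)\<^sup>2)" using sq by simp
    have "norm z \<le> 1 + (norm z)\<^sup>2" for z :: "(real^'n) \<times> (real^'n)"
    proof -
      have "0 \<le> (norm z - 1)\<^sup>2" by simp
      then have "2 * norm z \<le> 1 + (norm z)\<^sup>2" by (simp add: power2_diff)
      with norm_ge_zero[of z] show ?thesis by linarith
    qed
    then show "AE z in \<gamma>. norm (norm z) \<le> norm (1 + (norm z)\<^sup>2)" by auto
  qed (simp add: borel_\<gamma>)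
  have N_le: "N z \<le> 4 * r\<^sup>2" if "norm z \<le> r" for z r
  proof -
    have "norm (fst z - snd z) \<le> 2 * r"
      using norm_triangle_ineq4[of "fst z" "snd z"] norm_fs[of z] that by linarith
    from power_mono[OF this, of 2] show ?thesis by (simp add: N_def power_mult_distrib)
  qed
  have limN: "(\<lambda>n. \<integral>z. N (s n z) \<partial>\<gamma>) \<longlonglongrightarrow> (\<integral>z. N z \<partial>\<gamma>)"
  proof (rule integral_dominated_convergence)
    show "integrable \<gamma> (\<lambda>z. 4 * (2 * norm z)\<^sup>2)" using sq by (simp add: power_mult_distrib)
    show "N \<in> borel_measurable \<gamma>" using mN by (simp add: borel_\<gamma>)
    show "(\<lambda>z. N (s n z)) \<in> borel_measurable \<gamma>" for n using measurable_compose[OF ms mN] .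
    show "AE z in \<gamma>. (\<lambda>n. N (s n z)) \<longlonglongrightarrow> N z"
      unfolding N_def by (intro AE_I2 tendsto_intros s_lim)
    show "AE z in \<gamma>. norm (N (s n z)) \<le> 4 * (2 * norm z)\<^sup>2" for n
      using N_le[OF s_le, of n] by (intro AE_I2) (simp add: N_def)
  qed
  have "integrable \<gamma> N"
  proof (rule Bochner_Integration.integrable_bound)
    show "integrable \<gamma> (\<lambda>z. 4 * (norm z)\<^sup>2)" using sq by simp
    show "N \<in> borel_measurable \<gamma>" using mN by (simp add: borel_\<gamma>)
    show "AE z in \<gamma>. norm (N z) \<le> norm (4 * (norm z)\<^sup>2)"
      using N_le[OF order_refl] by (intro AE_I2) (simp add: N_def)
  qed
  then show "integrable \<gamma> (\<lambda>z. (norm (fst z - snd z))\<^sup>2)" by (simp add: N_def[abs_def])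
  define C where "C = sqrt (2 * lam3 + lam0\<^sup>2 + lam1\<^sup>2 / (2 * lam2))"
  have lip: "norm (dx G x m - dx G y m) \<le> C * norm (x - y)" if "m \<in> P2" for x y m
    unfolding C_def by (rule dx_lipschitz[OF \<open>lam2 > 0\<close> C2 anti that])
  have jc: "jointly_continuous (dx G)" using C1 by (simp add: fully_C1_def)
  have lim_mu: "(\<lambda>n. dx G (x' n) (\<mu>' n)) \<longlonglongrightarrow> dx G x \<mu>"
    and lim_nu: "(\<lambda>n. dx G (x' n) (\<nu>' n)) \<longlonglongrightarrow> dx G x \<nu>" if "x' \<longlonglongrightarrow> x" for x' x
    using jointly_continuous_tendsto[OF jc mu that mu' b_lim W(1)]
      jointly_continuous_tendsto[OF jc nu that nu' b_lim W(2)] .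
  \<comment> \<open>The gradients at the origin converge along the approximating measures and so are
    bounded. With the uniform Lipschitz constant this gives linear growth uniformly in
    \<open>n\<close>.\<close>
  obtain A1 where A1: "\<And>n. norm (dx G 0 (\<mu>' n)) \<le> A1"
    using convergent_imp_Bseq[OF convergentI[OF lim_mu[OF tendsto_const]]] by (auto simp: Bseq_def)
  obtain A2 where A2: "\<And>n. norm (dx G 0 (\<nu>' n)) \<le> A2"
    using convergent_imp_Bseq[OF convergentI[OF lim_nu[OF tendsto_const]]] by (auto simp: Bseq_def)
  \<comment> \<open>In HOL \<open>sqrt\<close> of a negative real is negative, so the absolute value
    secures the sign that the monotonicity steps below use.\<close>
  define c where "c = \<bar>C\<bar>"
  have c: "c \<ge> 0" "C \<le> c" by (auto simp: c_def)
  have growth: "norm (dx G x m) \<le> norm (dx G 0 m) + c * norm x" if "m \<in> P2" for x m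
  proof -
    have "norm (dx G x m) \<le> norm (dx G 0 m) + norm (dx G x m - dx G 0 m)"
      using norm_triangle_sub[of "dx G x m" "dx G 0 m"] by simp
    also have "norm (dx G x m - dx G 0 m) \<le> C * norm x" using lip[OF that, of x 0] by simp
    also have "C * norm x \<le> c * norm x" using c by (intro mult_right_mono) auto
    finally show ?thesis by simp
  qed
  \<comment> \<open>Linear growth of the gradients against \<open>|x - y| \<le> 2 r\<close> gives a
    quadratic bound. It is used with \<open>r = 2 * norm z\<close> at \<open>s n z\<close> and with
    \<open>r = norm z\<close> for the limit.\<close>
  have I_le: "\<bar>I m k z\<bar> \<le> (a + a') * 2 * r + 4 * c * r\<^sup>2"
    if "m \<in> P2" "k \<in> P2" "norm (dx G 0 m) \<le> a" "norm (dx G 0 k) \<le> a'" "norm z \<le> r" for m k z a a' r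
  proof -
    have zr: "norm (fst z) \<le> r" "norm (snd z) \<le> r" "0 \<le> r"
      using norm_fs[of z] that(5) norm_ge_zero[of z] by linarith+
    have "norm (dx G (fst z) m) \<le> a + c * r" "norm (dx G (snd z) k) \<le> a' + c * r"
      using growth[OF that(1), of "fst z"] growth[OF that(2), of "snd z"] that(3,4) zr
        mult_left_mono[OF zr(1) c(1)] mult_left_mono[OF zr(2) c(1)] by linarith+
    then have 1: "norm (dx G (fst z) m - dx G (snd z) k) \<le> (a + a') + 2 * c * r"
      using norm_triangle_ineq4[of "dx G (fst z) m" "dx G (snd z) k"] by linarith
    have 2: "norm (fst z - snd z) \<le> 2 * r"
      using norm_triangle_ineq4[of "fst z" "snd z"] zr by linarith
    have "\<bar>I m k z\<bar> \<le> norm (dx G (fst z) m - dx G (snd z) k) * norm (fst z - snd z)"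
      unfolding I_def by (rule Cauchy_Schwarz_ineq2)
    also have "\<dots> \<le> ((a + a') + 2 * c * r) * (2 * r)"
      using 1 2 order_trans[OF norm_ge_zero 1] by (intro mult_mono) auto
    also have "\<dots> = (a + a') * 2 * r + 4 * c * r\<^sup>2" by (simp add: algebra_simps power2_eq_square)
    finally show ?thesis .
  qed
  have dom: "integrable \<gamma> (\<lambda>z. a * 2 * (2 * norm z) + 4 * c * (2 * norm z)\<^sup>2)" for a
    using int_norm sq by (simp add: power_mult_distrib)
  have limI: "(\<lambda>n. \<integral>z. I (\<mu>' n) (\<nu>' n) (s n z) \<partial>\<gamma>) \<longlonglongrightarrow> (\<integral>z. I \<mu> \<nu> z \<partial>\<gamma>)"
  proof (rule integral_dominated_convergence[OF _ _ dom[of "A1 + A2"]])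
    show "I \<mu> \<nu> \<in> borel_measurable \<gamma>" using mI[OF mu nu] by (simp add: borel_\<gamma>)
    show "(\<lambda>z. I (\<mu>' n) (\<nu>' n) (s n z)) \<in> borel_measurable \<gamma>" for n
      using measurable_compose[OF ms mI[OF mu' nu']] .
    show "AE z in \<gamma>. (\<lambda>n. I (\<mu>' n) (\<nu>' n) (s n z)) \<longlonglongrightarrow> I \<mu> \<nu> z"
      unfolding I_def
      by (intro AE_I2 tendsto_inner tendsto_diff lim_mu lim_nu tendsto_fst tendsto_snd s_lim)
    show "AE z in \<gamma>. norm (I (\<mu>' n) (\<nu>' n) (s n z))
        \<le> (A1 + A2) * 2 * (2 * norm z) + 4 * c * (2 * norm z)\<^sup>2" for n
      unfolding real_norm_def by (intro AE_I2 I_le mu' nu' A1 A2 s_le)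
  qed
  have "integrable \<gamma> (I \<mu> \<nu>)"
  proof (rule Bochner_Integration.integrable_bound)
    let ?a = "norm (dx G 0 \<mu>) + norm (dx G 0 \<nu>)"
    show "integrable \<gamma> (\<lambda>z. ?a * 2 * (norm z) + 4 * c * (norm z)\<^sup>2)"
      using int_norm sq by simp
    show "I \<mu> \<nu> \<in> borel_measurable \<gamma>" using mI[OF mu nu] by (simp add: borel_\<gamma>)
    show "AE z in \<gamma>. norm (I \<mu> \<nu> z) \<le> norm (?a * 2 * (norm z) + 4 * c * (norm z)\<^sup>2)"
    proof (rule AE_I2)
      fix z
      have "\<bar>I \<mu> \<nu> z\<bar> \<le> ?a * 2 * (norm z) + 4 * c * (norm z)\<^sup>2"
        by (intro I_le mu nu order_refl)
      then show "norm (I \<mu> \<nu> z) \<le> norm (?a * 2 * (norm z) + 4 * c * (norm z)\<^sup>2)"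
        unfolding real_norm_def by linarith
    qed
  qed
  then show "integrable \<gamma> (\<lambda>z. (dx G (fst z) \<mu> - dx G (snd z) \<nu>) \<bullet> (fst z - snd z))"
    by (simp add: I_def[abs_def])
  \<comment> \<open>\<open>Z\<close> on \<open>Omega\<close> and \<open>s n\<close> on
    \<open>\<gamma>\<close> have the same law, and each integral depends on that law only.\<close>
  have ineq: "- ?a * (\<integral>z. N (s n z) \<partial>\<gamma>) \<le> (\<integral>z. I (\<mu>' n) (\<nu>' n) (s n z) \<partial>\<gamma>)" for n
  proof -
    obtain Z where Z: "Z \<in> borel_measurable Omega" and rng: "range Z \<subseteq> s n ` space \<gamma>"
      and dZ: "distr Omega borel Z = distr \<gamma> borel (s n)"
      using finite_range_realization[OF p\<gamma> s] by blast
    have "finite (range Z)" using rng s[of n] by (auto simp: simple_function_def dest: finite_subset)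
    from finite_coupling_displacement[OF C2 anti lower Z this]
    have "- ?a * (\<integral>w. N (Z w) \<partial>Omega)
        \<le> (\<integral>w. I (distr Omega borel (\<lambda>w. fst (Z w))) (distr Omega borel (\<lambda>w. snd (Z w))) (Z w) \<partial>Omega)"
      by (simp add: N_def I_def)
    also have "distr Omega borel (\<lambda>w. fst (Z w)) = \<mu>' n"
      using distr_distr[OF mfs(3) Z] distr_distr[OF mfs(3) ms[of n]] by (simp add: dZ \<mu>'_def comp_def)
    also have "distr Omega borel (\<lambda>w. snd (Z w)) = \<nu>' n"
      using distr_distr[OF mfs(4) Z] distr_distr[OF mfs(4) ms[of n]] by (simp add: dZ \<nu>'_def comp_def)
    also have "(\<integral>w. N (Z w) \<partial>Omega) = (\<integral>z. N (s n z) \<partial>\<gamma>)"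
      using integral_distr[OF Z mN] integral_distr[OF ms[of n] mN] by (simp add: dZ)
    also have "(\<integral>w. I (\<mu>' n) (\<nu>' n) (Z w) \<partial>Omega) = (\<integral>z. I (\<mu>' n) (\<nu>' n) (s n z) \<partial>\<gamma>)"
      using integral_distr[OF Z mI[OF mu' nu']] integral_distr[OF ms[of n] mI[OF mu' nu']] by (simp add: dZ)
    finally show ?thesis .
  qed
  have "- ?a * (\<integral>z. N z \<partial>\<gamma>) \<le> (\<integral>z. I \<mu> \<nu> z \<partial>\<gamma>)"
    using tendsto_mult[OF tendsto_const limN] limI by (rule LIMSEQ_le) (use ineq in auto)
  then show "- ?a * (\<integral>z. (norm (fst z - snd z))\<^sup>2 \<partial>\<gamma>)
      \<le> (\<integral>z. (dx G (fst z) \<mu> - dx G (snd z) \<nu>) \<bullet> (fst z - snd z) \<partial>\<gamma>)"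
    by (simp add: N_def I_def)
qed

\<comment> \<open>The quadratic term adds \<open>\<alpha> |x - y|^2\<close> to the integrand,
  exactly what the lower bound for couplings may lack.\<close>
schematic_goal anti_monotone_displacement:
  fixes G :: "real^'n \<Rightarrow> (real^'n) measure \<Rightarrow> real"
  assumes "lam2 > 0" and C2: "fully_C2 G" and anti: "anti_monotone lam0 lam1 lam2 lam3 G"
  shows "displacement_alpha_monotone ?alpha G"
proof -
  define \<alpha> where "\<alpha> = (\<bar>lam1\<bar> / (2 * lam2)
      + sqrt (lam3 / lam2 + lam0\<^sup>2 / (4 * lam2) + (lam1 / (2 * lam2))\<^sup>2))
    + (\<bar>lam0\<bar> / 2 + sqrt (lam3 + (lam0 / 2)\<^sup>2 + lam2 * (lam1 / (2 * lam2))\<^sup>2))"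
  have C1: "fully_C1 G" using C2 by (simp add: fully_C2_def)
  have "displacement_alpha_monotone \<alpha> G"
    unfolding displacement_alpha_monotone_def displacement_monotone_def
  proof (intro conjI ballI)
    show "fully_C1 (\<lambda>x \<mu>. G x \<mu> + \<alpha> / 2 * (norm x)\<^sup>2)"
      using C1 by (rule fully_C1_add_quadratic)
    fix \<mu> \<nu> :: "(real^'n) measure" and \<gamma>
    assume mu: "\<mu> \<in> P2" and nu: "\<nu> \<in> P2" and gam: "\<gamma> \<in> couplings \<mu> \<nu>"
    note cd = coupling_displacement[OF \<open>lam2 > 0\<close> C2 anti mu nu gam,
        folded \<alpha>_def]
    have eq: "(\<lambda>(x, y). (dx (\<lambda>x \<mu>. G x \<mu> + \<alpha> / 2 * (norm x)\<^sup>2) x \<mu>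
          - dx (\<lambda>x \<mu>. G x \<mu> + \<alpha> / 2 * (norm x)\<^sup>2) y \<nu>) \<bullet> (x - y))
        = (\<lambda>z. (dx G (fst z) \<mu> - dx G (snd z) \<nu>) \<bullet> (fst z - snd z) + \<alpha> * (norm (fst z - snd z))\<^sup>2)"
      unfolding fully_C1_add_quadratic(2)[OF C1 mu] fully_C1_add_quadratic(2)[OF C1 nu]
      by (simp add: fun_eq_iff power2_norm_eq_inner algebra_simps)
    show "integrable \<gamma> (\<lambda>(x, y). (dx (\<lambda>x \<mu>. G x \<mu> + \<alpha> / 2 * (norm x)\<^sup>2) x \<mu>
          - dx (\<lambda>x \<mu>. G x \<mu> + \<alpha> / 2 * (norm x)\<^sup>2) y \<nu>) \<bullet> (x - y))"
      unfolding eq using cd(1,2) by simp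
    show "0 \<le> (\<integral>(x, y). (dx (\<lambda>x \<mu>. G x \<mu> + \<alpha> / 2 * (norm x)\<^sup>2) x \<mu>
          - dx (\<lambda>x \<mu>. G x \<mu> + \<alpha> / 2 * (norm x)\<^sup>2) y \<nu>) \<bullet> (x - y) \<partial>\<gamma>)"
      unfolding eq using cd by simp
  qed
  then show "displacement_alpha_monotone ((\<bar>lam1\<bar> / (2 * lam2)
      + sqrt (lam3 / lam2 + lam0\<^sup>2 / (4 * lam2) + (lam1 / (2 * lam2))\<^sup>2))
    + (\<bar>lam0\<bar> / 2 + sqrt (lam3 + (lam0 / 2)\<^sup>2 + lam2 * (lam1 / (2 * lam2))\<^sup>2))) G"
    by (simp only: \<alpha>_def)
qed

theorem proposition3p10:
  fixes lam0 lam1 lam2 lam3 :: real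
  assumes "lam0 > 0" and "lam2 > 0" and "lam3 \<ge> 0"
  shows
    "(\<forall>G :: real^'n \<Rightarrow> (real^'n) measure \<Rightarrow> real.
        fully_C2 G \<and> anti_monotone lam0 lam1 lam2 lam3 G \<longrightarrow>
        (\<forall>\<mu>\<in>P2. \<forall>\<xi>\<in>L2 \<mu>.
           \<bar>\<integral>(x, y). (\<xi> x v* dxmu G x \<mu> y) \<bullet> \<xi> y \<partial>(\<mu> \<Otimes>\<^sub>M \<mu>)\<bar>
             \<le> (\<bar>lam1\<bar> / (2 * lam2)
                  + sqrt (lam3 / lam2 + lam0\<^sup>2 / (4 * lam2) + (lam1 / (2 * lam2))\<^sup>2))
                * (\<integral>x. (norm (\<xi> x))\<^sup>2 \<partial>\<mu>) \<and>
           \<bar>\<integral>x. (dxx G x \<mu> *v \<xi> x) \<bullet> \<xi> x \<partial>\<mu>\<bar>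
             \<le> (\<bar>lam0\<bar> / 2
                  + sqrt (lam3 + (lam0 / 2)\<^sup>2 + lam2 * (lam1 / (2 * lam2))\<^sup>2))
                * (\<integral>x. (norm (\<xi> x))\<^sup>2 \<partial>\<mu>)))
     \<and>
     (\<exists>\<alpha>. \<alpha> \<ge> max (\<bar>lam1\<bar> / (2 * lam2)
                     + sqrt (lam3 / lam2 + lam0\<^sup>2 / (4 * lam2) + (lam1 / (2 * lam2))\<^sup>2))
                   (\<bar>lam0\<bar> / 2
                     + sqrt (lam3 + (lam0 / 2)\<^sup>2 + lam2 * (lam1 / (2 * lam2))\<^sup>2)) \<and>
        (\<forall>G :: real^'n \<Rightarrow> (real^'n) measure \<Rightarrow> real.
           fully_C2 G \<and> anti_monotone lam0 lam1 lam2 lam3 G \<longrightarrow>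
           displacement_alpha_monotone \<alpha> G))"
proof (intro conjI allI impI ballI)
  fix G :: "real^'n \<Rightarrow> (real^'n) measure \<Rightarrow> real" and \<mu> and \<xi> :: "real^'n \<Rightarrow> real^'n"
  assume "fully_C2 G \<and> anti_monotone lam0 lam1 lam2 lam3 G" "\<mu> \<in> P2" "\<xi> \<in> L2 \<mu>"
  then show "\<bar>\<integral>(x, y). (\<xi> x v* dxmu G x \<mu> y) \<bullet> \<xi> y \<partial>(\<mu> \<Otimes>\<^sub>M \<mu>)\<bar>
             \<le> (\<bar>lam1\<bar> / (2 * lam2)
                  + sqrt (lam3 / lam2 + lam0\<^sup>2 / (4 * lam2) + (lam1 / (2 * lam2))\<^sup>2))
                * (\<integral>x. (norm (\<xi> x))\<^sup>2 \<partial>\<mu>)"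
    and "\<bar>\<integral>x. (dxx G x \<mu> *v \<xi> x) \<bullet> \<xi> x \<partial>\<mu>\<bar>
             \<le> (\<bar>lam0\<bar> / 2
                  + sqrt (lam3 + (lam0 / 2)\<^sup>2 + lam2 * (lam1 / (2 * lam2))\<^sup>2))
                * (\<integral>x. (norm (\<xi> x))\<^sup>2 \<partial>\<mu>)"
    using anti_monotone_bounds(1,2)[OF \<open>lam2 > 0\<close>] by blast+
next
  define c1 where "c1 = \<bar>lam1\<bar> / (2 * lam2)
    + sqrt (lam3 / lam2 + lam0\<^sup>2 / (4 * lam2) + (lam1 / (2 * lam2))\<^sup>2)"
  define c2 where "c2 = \<bar>lam0\<bar> / 2 + sqrt (lam3 + (lam0 / 2)\<^sup>2 + lam2 * (lam1 / (2 * lam2))\<^sup>2)"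
  \<comment> \<open>The witness \<open>c1 + c2\<close> is chosen before \<open>G\<close>;
    nonnegativity of both summands puts it above their maximum.\<close>
  have "c1 \<ge> 0" "c2 \<ge> 0" using assms by (simp_all add: c1_def c2_def)
  then have "c1 + c2 \<ge> max c1 c2" by simp
  moreover have "displacement_alpha_monotone (c1 + c2) G"
    if "fully_C2 G" "anti_monotone lam0 lam1 lam2 lam3 G"
    for G :: "real^'n \<Rightarrow> (real^'n) measure \<Rightarrow> real"
    unfolding c1_def c2_def by (rule anti_monotone_displacement[OF \<open>lam2 > 0\<close> that])
  ultimately show "\<exists>\<alpha>. \<alpha> \<ge> max (\<bar>lam1\<bar> / (2 * lam2)
                     + sqrt (lam3 / lam2 + lam0\<^sup>2 / (4 * lam2) + (lam1 / (2 * lam2))\<^sup>2))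
                   (\<bar>lam0\<bar> / 2
                     + sqrt (lam3 + (lam0 / 2)\<^sup>2 + lam2 * (lam1 / (2 * lam2))\<^sup>2)) \<and>
        (\<forall>G :: real^'n \<Rightarrow> (real^'n) measure \<Rightarrow> real.
           fully_C2 G \<and> anti_monotone lam0 lam1 lam2 lam3 G \<longrightarrow>
           displacement_alpha_monotone \<alpha> G)"
    unfolding c1_def c2_def by blast
qed

end
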